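(* Let $F$ be a full vertex algebra, and suppose that the spectrum of $\ker\bar D$ is discrete and the spectrum of $\ker D$ is bounded below, so that the tensor product full vertex algebra $\ker\bar D\otimes\ker D$ is defined. Then the linear map $t:\ker\bar D\otimes\ker D\to F$, $a\otimes b\mapsto a(-1,-1)b$, is a full vertex algebra homomorphism.
   Context: **Formal series.** The base field is $\mathbb C$. $z,\bar z$ are independent formal variables (also used for a complex number and its conjugate), $\underline z=(z,\bar z)$, and by convention $|z|:=z\bar z$, so $|z|^r=z^r\bar z^r$. For a vector space $W$: $W[[z,\bar z,|z|^{\mathbb R}]]$ is the space of formal sums $\sum_{s,\bar s\in\mathbb R}a_{s,\bar s}z^s\bar z^{\bar s}$ with $a_{s,\bar s}\in W$ and $a_{s,\bar s}=0$ unless $s-\bar s\in\mathbb Z$; $W[[z,\bar z]]$ is the subspace of sums over $s,\bar s\in\mathbb Z_{\ge0}$; $W((z,\bar z,|z|^{\mathbb R}))$ is the subspace of series such that (i) there is $N\in\mathbb R$ with $a_{s,\bar s}=0$ if $s\le N$ or $\bar s\le N$, and (ii) for every $R\in\mathbb R$ the set $\{(s,\bar s): a_{s,\bar s}\ne0,\ s+\bar s\le R\}$ is finite. A series in $\mathbb C((z,\bar z,|z|^{\mathbb R}))$ is absolutely convergent around $0$ if, after multiplication by some $|z|^N$ making all exponents nonnegative, $\sum|a_{s,\bar s}|R^{s+\bar s}<\infty$ for some $R>0$. **Correlation functions.** $F_{0,1,\infty}$ is the space of complex-valued real analytic functions $f$ on $\mathbb CP^1\setminus\{0,1,\infty\}$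 with conformal singularities at $0,1,\infty$: for each $\alpha\in\{0,1,\infty\}$ and each chart $\chi$ (biholomorphism from a neighbourhood of $\alpha$ to an open subset of $\mathbb C$, $\chi(\alpha)=0$) there is a series in $\mathbb C((z,\bar z,|z|^{\mathbb R}))$, absolutely convergent around $0$, converging to $f\circ\chi^{-1}(z)$ on a punctured disc at $0$; this (unique) series is denoted $j(\chi,f)$. Let $Y_2=\{(z_1,z_2)\in\mathbb C^2: z_1\ne z_2,z_1\ne0,z_2\neq0\}$ and let $\mathrm{GCor}_2$ be the span of the functions $\mu=z_1^\alpha\bar z_1^\beta f(z_2/z_1)$ on $Y_2$, $f\in F_{0,1,\infty}$, $\alpha,\beta\in\mathbb R$, $\alpha-\beta\in\mathbb Z$. Its expansions are (with $z_0=z_1-z_2$): $\mu|_{|z_1|>|z_2|}=z_1^\alpha\bar z_1^\beta\,j(z,f)|_{z=z_2/z_1}$; $\mu|_{|z_2|>|z_1|}=z_1^\alpha\bar z_1^\beta\,j(z^{-1},f)|_{z=z_1/z_2}$; $\mu|_{|z_2|>|z_1-z_2|}=z_2^\alpha\bar z_2^\beta\sum_{i,k\ge0}\binom\alpha i\binom\beta k(z_0/z_2)^i(\bar z_0/\bar z_2)^k\,j(1-z^{-1},f)|_{z=-z_0/z_2}$, where $z\mapsto -z_0/z_2$ sends $z^s\bar z^{\bar s}$ to $(-1)^{s-\bar s}(z_0/z_2)^s(\bar z_0/\bar z_2)^{\bar s}$. **Full vertex algebra.** An $\mathbb R^2$-graded vector space $F=\bigoplus_{h,\bar h\in\mathbb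 R}F_{h,\bar h}$ with a linear map $Y(-,\underline z):F\to\mathrm{End}(F)[[z,\bar z,|z|^{\mathbb R}]]$, $Y(a,\underline z)=\sum_{r,s\in\mathbb R}a(r,s)z^{-r-1}\bar z^{-s-1}$, and $\mathbf 1\in F_{0,0}$ such that, with $F^\vee=\bigoplus F_{h,\bar h}^*$: (FV1) $Y(a,\underline z)b\in F((z,\bar z,|z|^{\mathbb R}))$; (FV2) $F_{h,\bar h}=0$ unless $h-\bar h\in\mathbb Z$; (FV3) $Y(a,\underline z)\mathbf 1\in F[[z,\bar z]]$ with constant term $a(-1,-1)\mathbf 1=a$; (FV4) $Y(\mathbf 1,\underline z)=\mathrm{id}$; (FV5) for all $a,b,c\in F$, $u\in F^\vee$ there is $\mu\in\mathrm{GCor}_2$ with $u(Y(a,\underline z_1)Y(b,\underline z_2)c)=\mu|_{|z_1|>|z_2|}$, $u(Y(Y(a,\underline z_0)b,\underline z_2)c)=\mu|_{|z_2|>|z_1-z_2|}$, $u(Y(b,\underline z_2)Y(a,\underline z_1)c)=\mu|_{|z_2|>|z_1|}$; (FV6) for $a\in F_{h,\bar h}$, $a(r,s)F_{h',\bar h'}\subset F_{h+h'-r-1,\bar h+\bar h'-s-1}$. Put $Da=a(-2,-1)\mathbf 1$, $\bar Da=a(-1,-2)\mathbf 1$; $\ker\bar D$ and $\ker D$ are graded subalgebras of $F$. A homomorphism of full vertex algebras is a linear map $f$ with $f(\mathbf 1)=\mathbf 1$ and $f(Y(a,\underline z)b)=Y(f(a),\underline z)f(b)$. The spectrum of $F$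 is bounded below if there is $N\in\mathbb R$ with $F_{h,\bar h}=0$ for $h\le N$ or $\bar h\le N$, and discrete if $\sum_{h+\bar h<K}\dim F_{h,\bar h}<\infty$ for every $K\in\mathbb R$. If $F^1$ has discrete spectrum and $F^2$ has spectrum bounded below, $F^1\otimes F^2$ is the full vertex algebra with $Y(a\otimes b,\underline z)=Y^1(a,\underline z)\otimes Y^2(b,\underline z)$, vacuum $\mathbf 1\otimes\mathbf 1$, and the sum grading. *)

theory Defs
  imports "HOL-Complex_Analysis.Complex_Analysis" "HOL-Library.Poly_Mapping"
begin

section \<open>Complex vector spaces\<close>

class complex_vector = ab_group_add +
  fixes scaleC :: "complex \<Rightarrow> 'a \<Rightarrow> 'a"
  assumes scaleC_add_right: "scaleC c (x + y) = scaleC c x + scaleC c y"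
    and scaleC_add_left: "scaleC (c + d) x = scaleC c x + scaleC d x"
    and scaleC_scaleC: "scaleC c (scaleC d x) = scaleC (c * d) x"
    and scaleC_one: "scaleC 1 x = x"

global_interpretation cvs: vector_space "scaleC :: complex \<Rightarrow> 'a \<Rightarrow> 'a::complex_vector"
  by unfold_locales
    (simp_all add: scaleC_add_right scaleC_add_left scaleC_scaleC scaleC_one)

instantiation complex :: complex_vector
begin
definition scaleC_complex :: "complex \<Rightarrow> complex \<Rightarrow> complex" where
  "scaleC_complex c x = c * x"
instance
  by standard (simp_all add: scaleC_complex_def algebra_simps)
end

text \<open>
  All vector spaces below are subspaces \<open>V\<close> of an ambient type of class
  \<^class>\<open>complex_vector\<close>; maps on \<open>V\<close> are functions on the ambient type of which only the
  values on \<open>V\<close> matter.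
\<close>

definition linear_on :: "'a::complex_vector set \<Rightarrow> ('a \<Rightarrow> 'b::complex_vector) \<Rightarrow> bool" where
  "linear_on V f \<longleftrightarrow>
     (\<forall>x\<in>V. \<forall>y\<in>V. f (x + y) = f x + f y) \<and> (\<forall>c. \<forall>x\<in>V. f (scaleC c x) = scaleC c (f x))"

definition bilinear_on ::
  "'a::complex_vector set \<Rightarrow> 'b::complex_vector set \<Rightarrow> ('a \<Rightarrow> 'b \<Rightarrow> 'c::complex_vector) \<Rightarrow> bool" where
  "bilinear_on V W B \<longleftrightarrow> (\<forall>w\<in>W. linear_on V (\<lambda>v. B v w)) \<and> (\<forall>v\<in>V. linear_on W (B v))"

definition is_direct_sum :: "'a::complex_vector set \<Rightarrow> ('i \<Rightarrow> 'a set) \<Rightarrow> bool" where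
  "is_direct_sum V G \<longleftrightarrow>
     cvs.subspace V \<and> (\<forall>i. cvs.subspace (G i) \<and> G i \<subseteq> V) \<and>
     (\<forall>v\<in>V. \<exists>!x. (\<forall>i. x i \<in> G i) \<and> finite {i. x i \<noteq> 0} \<and> v = (\<Sum>i | x i \<noteq> 0. x i))"

definition edim :: "'a::complex_vector set \<Rightarrow> ennreal" where
  "edim V = (if \<exists>B. finite B \<and> V \<subseteq> cvs.span B then of_nat (cvs.dim V) else \<infinity>)"

section \<open>Tensor products\<close>

instantiation poly_mapping :: (type, complex_vector) complex_vector
begin
lift_definition scaleC_poly_mapping ::
  "complex \<Rightarrow> ('a \<Rightarrow>\<^sub>0 'b) \<Rightarrow> ('a \<Rightarrow>\<^sub>0 'b)" is "\<lambda>c p k. scaleC c (p k)"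
  by (metis (mono_tags, lifting) cvs.scale_zero_right finite_subset mem_Collect_eq subsetI)
instance
  by standard (transfer; simp add: fun_eq_iff scaleC_add_right scaleC_add_left scaleC_scaleC scaleC_one)+
end

abbreviation free_pair :: "'a \<Rightarrow> 'b \<Rightarrow> ('a \<times> 'b) \<Rightarrow>\<^sub>0 complex" where
  "free_pair a b \<equiv> Poly_Mapping.single (a, b) 1"

definition tensor_relators ::
  "(('a::complex_vector \<times> 'b::complex_vector) \<Rightarrow>\<^sub>0 complex) set" where
  "tensor_relators =
     {free_pair (a + a') b - free_pair a b - free_pair a' b | a a' b. True} \<union>
     {free_pair a (b + b') - free_pair a b - free_pair a b' | a b b'. True} \<union>
     {free_pair (scaleC c a) b - scaleC c (free_pair a b) | c a b. True} \<union>
     {free_pair a (scaleC c b) - scaleC c (free_pair a b) | c a b. True}"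

definition tensor_rel ::
  "(('a::complex_vector \<times> 'b::complex_vector) \<Rightarrow>\<^sub>0 complex) \<Rightarrow>
   (('a \<times> 'b) \<Rightarrow>\<^sub>0 complex) \<Rightarrow> bool" where
  "tensor_rel x y \<longleftrightarrow> x - y \<in> cvs.span tensor_relators"

quotient_type (overloaded) ('a, 'b) tensor =
  "('a::complex_vector \<times> 'b::complex_vector) \<Rightarrow>\<^sub>0 complex" / tensor_rel
proof (rule equivpI)
  show "reflp (tensor_rel :: ('a \<times> 'b \<Rightarrow>\<^sub>0 complex) \<Rightarrow> _)"
    by (auto simp: reflp_def tensor_rel_def cvs.span_zero)
  show "symp (tensor_rel :: ('a \<times> 'b \<Rightarrow>\<^sub>0 complex) \<Rightarrow> _)"
    unfolding symp_def tensor_rel_def by (metis cvs.span_neg minus_diff_eq)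
  show "transp (tensor_rel :: ('a \<times> 'b \<Rightarrow>\<^sub>0 complex) \<Rightarrow> _)"
    unfolding transp_def tensor_rel_def by (auto dest: cvs.span_add)
qed

instantiation tensor :: (complex_vector, complex_vector) complex_vector
begin
lift_definition zero_tensor :: "('a, 'b) tensor" is 0 .
lift_definition plus_tensor :: "('a, 'b) tensor \<Rightarrow> ('a, 'b) tensor \<Rightarrow> ('a, 'b) tensor" is "(+)"
  unfolding tensor_rel_def by (subst add_diff_add) (rule cvs.span_add)
lift_definition minus_tensor :: "('a, 'b) tensor \<Rightarrow> ('a, 'b) tensor \<Rightarrow> ('a, 'b) tensor" is "(-)"
proof -
  fix x y z w :: "('a \<times> 'b) \<Rightarrow>\<^sub>0 complex"
  assume "tensor_rel x y" "tensor_rel z w"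
  then have "(x - y) - (z - w) \<in> cvs.span tensor_relators"
    unfolding tensor_rel_def by (rule cvs.span_diff)
  then show "tensor_rel (x - z) (y - w)"
    unfolding tensor_rel_def by (simp add: algebra_simps)
qed
lift_definition uminus_tensor :: "('a, 'b) tensor \<Rightarrow> ('a, 'b) tensor" is uminus
proof -
  fix x y :: "('a \<times> 'b) \<Rightarrow>\<^sub>0 complex"
  assume "tensor_rel x y"
  then have "- (x - y) \<in> cvs.span tensor_relators"
    unfolding tensor_rel_def by (rule cvs.span_neg)
  then show "tensor_rel (- x) (- y)"
    unfolding tensor_rel_def by (simp add: algebra_simps)
qed
lift_definition scaleC_tensor :: "complex \<Rightarrow> ('a, 'b) tensor \<Rightarrow> ('a, 'b) tensor" is scaleC
  unfolding tensor_rel_def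
  by (subst cvs.scale_right_diff_distrib[symmetric]) (rule cvs.span_scale)
instance
  by standard
    (transfer; simp add: tensor_rel_def algebra_simps cvs.span_zero
      scaleC_add_right scaleC_add_left scaleC_scaleC scaleC_one)+
end

lift_definition tensor_pure ::
  "'a::complex_vector \<Rightarrow> 'b::complex_vector \<Rightarrow> ('a, 'b) tensor" (infixr "\<otimes>" 75)
  is free_pair .

text \<open>
  For subspaces \<open>V\<close> and \<open>W\<close> of the ambient spaces, the tensor product of \<open>V\<close> and \<open>W\<close> is the span
  of the pure tensors \<open>v \<otimes> w\<close> inside the tensor product of the ambient spaces; over a field the
  canonical map from the abstract tensor product of \<open>V\<close> and \<open>W\<close> to this span is an isomorphism
  (\<open>tensor_lift_pure\<close> below is the universal property).
\<close>

definition tensor_space ::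
  "'a::complex_vector set \<Rightarrow> 'b::complex_vector set \<Rightarrow> ('a, 'b) tensor set" where
  "tensor_space V W = cvs.span {v \<otimes> w | v w. v \<in> V \<and> w \<in> W}"

text \<open>
  The linear map on \<^term>\<open>tensor_space V W\<close> induced by a bilinear map on \<open>V \<times> W\<close>. It is determined
  on \<^term>\<open>tensor_space V W\<close>; outside of it an arbitrary linear extension is chosen.
\<close>

definition tensor_lift ::
  "'a::complex_vector set \<Rightarrow> 'b::complex_vector set \<Rightarrow> ('a \<Rightarrow> 'b \<Rightarrow> 'c::complex_vector) \<Rightarrow>
   ('a, 'b) tensor \<Rightarrow> 'c" where
  "tensor_lift V W B = (SOME T. linear_on UNIV T \<and> (\<forall>v\<in>V. \<forall>w\<in>W. T (v \<otimes> w) = B v w))"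

lemma tensor_lift_exists_UNIV:
  fixes B :: "'a::complex_vector \<Rightarrow> 'b::complex_vector \<Rightarrow> 'c::complex_vector"
  assumes B: "bilinear_on UNIV UNIV B"
  shows "\<exists>T. linear_on UNIV T \<and> (\<forall>v w. T (v \<otimes> w) = B v w)"
proof -
  define L :: "(('a \<times> 'b) \<Rightarrow>\<^sub>0 complex) \<Rightarrow> 'c" where
    "L p = (\<Sum>k\<in>Poly_Mapping.keys p. scaleC (poly_mapping.lookup p k) (B (fst k) (snd k)))" for p
  have L_sup: "L p = (\<Sum>k\<in>S. scaleC (poly_mapping.lookup p k) (B (fst k) (snd k)))"
    if "finite S" "Poly_Mapping.keys p \<subseteq> S" for p S
    unfolding L_def using that
    by (intro sum.mono_neutral_left) (auto simp: in_keys_iff)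
  have L_add: "L (p + q) = L p + L q" for p q
  proof -
    let ?S = "Poly_Mapping.keys p \<union> Poly_Mapping.keys q"
    have "Poly_Mapping.keys (p + q) \<subseteq> ?S" by (rule Poly_Mapping.keys_add)
    then show ?thesis
      by (simp add: L_sup[of ?S] lookup_add scaleC_add_left sum.distrib)
  qed
  have L_scale: "L (scaleC c p) = scaleC c (L p)" for c p
  proof -
    have lk: "poly_mapping.lookup (scaleC c p) k = c * poly_mapping.lookup p k" for k
      by (transfer) (simp add: scaleC_complex_def)
    have "Poly_Mapping.keys (scaleC c p) \<subseteq> Poly_Mapping.keys p"
      by (auto simp: in_keys_iff lk)
    then show ?thesis
      by (simp add: L_sup[of "Poly_Mapping.keys p"] lk cvs.scale_sum_right)
  qed
  have L_diff: "L (p - q) = L p - L q" for p q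
    using L_add[of "p - q" q] by (simp add: algebra_simps)
  have L_pair: "L (free_pair a b) = B a b" for a b
    by (simp add: L_def scaleC_one)
  have B_simps: "B (a + a') b = B a b + B a' b" "B a (b + b') = B a b + B a b'"
    "B (scaleC c a) b = scaleC c (B a b)" "B a (scaleC c b) = scaleC c (B a b)" for a a' b b' c
    using B by (auto simp: bilinear_on_def linear_on_def)
  have "L x = 0" if "x \<in> cvs.span tensor_relators" for x
    using that
  proof (induction rule: cvs.span_induct_alt)
    case base
    show ?case by (simp add: L_def)
  next
    case (step c x y)
    have "L x = 0"
      using step(1) unfolding tensor_relators_def
      by (auto simp: L_diff L_pair L_scale B_simps)
    then show ?case
      using step(2) by (simp add: L_add L_scale)
  qed
  then have L_rel: "L x = L y" if "tensor_rel x y" for x y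
    using that L_diff[of x y] by (auto simp: tensor_rel_def)
  define T where "T t = L (rep_tensor t)" for t
  have T_abs: "T (abs_tensor x) = L x" for x
    unfolding T_def
    by (intro L_rel tensor.abs_eq_iff[THEN iffD1] Quotient3_abs_rep[OF Quotient3_tensor])
  have "T (s + t) = T s + T t" for s t
    by (induction s rule: tensor.abs_induct, induction t rule: tensor.abs_induct)
      (simp add: plus_tensor.abs_eq T_abs L_add)
  moreover have "T (scaleC c s) = scaleC c (T s)" for c s
    by (induction s rule: tensor.abs_induct) (simp add: scaleC_tensor.abs_eq T_abs L_scale)
  moreover have "T (v \<otimes> w) = B v w" for v w
    by (simp add: tensor_pure.abs_eq T_abs L_pair)
  ultimately show ?thesis
    unfolding linear_on_def by blast
qed

lemma subspace_projection:
  fixes V :: "'a::complex_vector set"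
  assumes "cvs.subspace V"
  obtains P where "linear_on UNIV P" "\<And>x. P x \<in> V" "\<And>v. v \<in> V \<Longrightarrow> P v = v"
proof -
  interpret vector_space_pair "scaleC :: complex \<Rightarrow> 'a \<Rightarrow> 'a" "scaleC :: complex \<Rightarrow> 'a \<Rightarrow> 'a" ..
  have "\<exists>g. g ` UNIV \<subseteq> V \<and> Vector_Spaces.linear scaleC scaleC g \<and> (\<forall>v\<in>V. g (id v) = v)"
    by (rule linear_exists_left_inverse_on[OF cvs.linear_id assms]) simp
  then obtain g where g: "range g \<subseteq> V" "Vector_Spaces.linear scaleC scaleC g" "\<forall>v\<in>V. g v = v"
    by auto
  interpret g: Vector_Spaces.linear scaleC scaleC g by (rule g)
  show ?thesis
    using g by (intro that[of g]) (auto simp: linear_on_def g.add g.scale)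
qed

lemma tensor_lift_pure:
  fixes B :: "'a::complex_vector \<Rightarrow> 'b::complex_vector \<Rightarrow> 'c::complex_vector"
  assumes V: "cvs.subspace V" and W: "cvs.subspace W" and B: "bilinear_on V W B"
  shows "linear_on UNIV (tensor_lift V W B)"
    and "v \<in> V \<Longrightarrow> w \<in> W \<Longrightarrow> tensor_lift V W B (v \<otimes> w) = B v w"
proof -
  obtain P where P: "linear_on UNIV P" "\<And>x. P x \<in> V" "\<And>v. v \<in> V \<Longrightarrow> P v = v"
    using subspace_projection[OF V] by blast
  obtain Q where Q: "linear_on UNIV Q" "\<And>x. Q x \<in> W" "\<And>w. w \<in> W \<Longrightarrow> Q w = w"
    using subspace_projection[OF W] by blast
  have "bilinear_on UNIV UNIV (\<lambda>v w. B (P v) (Q w))"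
    using B P Q by (simp add: bilinear_on_def linear_on_def)
  then obtain T where "linear_on UNIV T" "\<forall>v w. T (v \<otimes> w) = B (P v) (Q w)"
    using tensor_lift_exists_UNIV by blast
  then have "\<exists>T. linear_on UNIV T \<and> (\<forall>v\<in>V. \<forall>w\<in>W. T (v \<otimes> w) = B v w)"
    using P Q by auto
  then have "linear_on UNIV (tensor_lift V W B) \<and>
      (\<forall>v\<in>V. \<forall>w\<in>W. tensor_lift V W B (v \<otimes> w) = B v w)"
    unfolding tensor_lift_def by (rule someI_ex)
  then show "linear_on UNIV (tensor_lift V W B)"
    and "v \<in> V \<Longrightarrow> w \<in> W \<Longrightarrow> tensor_lift V W B (v \<otimes> w) = B v w"
    by auto
qed

section \<open>Formal series\<close>

text \<open>
  A formal sum of terms \<open>a s t z\<^sup>s \<zbar>\<^sup>t\<close> over real \<open>s\<close>, \<open>t\<close> is represented by its coefficient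
  function \<open>a\<close>. The next three predicates describe \<open>W[[z,\<zbar>,|z|\<^sup>\<real>]]\<close>, \<open>W[[z,\<zbar>]]\<close> and
  \<open>W((z,\<zbar>,|z|\<^sup>\<real>))\<close>.
\<close>

type_synonym 'w series = "real \<Rightarrow> real \<Rightarrow> 'w"

definition real_series :: "'w::zero series \<Rightarrow> bool" where
  "real_series a \<longleftrightarrow> (\<forall>s t. a s t \<noteq> 0 \<longrightarrow> s - t \<in> \<int>)"

definition power_series :: "'w::zero series \<Rightarrow> bool" where
  "power_series a \<longleftrightarrow> (\<forall>s t. a s t \<noteq> 0 \<longrightarrow> s \<in> \<nat> \<and> t \<in> \<nat>)"

definition laurent_series :: "'w::zero series \<Rightarrow> bool" where
  "laurent_series a \<longleftrightarrow> real_series a \<and>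
     (\<exists>N. \<forall>s t. s \<le> N \<or> t \<le> N \<longrightarrow> a s t = 0) \<and>
     (\<forall>R. finite {(s, t). a s t \<noteq> 0 \<and> s + t \<le> R})"

definition abs_conv_at_0 :: "complex series \<Rightarrow> bool" where
  "abs_conv_at_0 a \<longleftrightarrow>
     (\<exists>N. (\<forall>s t. a s t \<noteq> 0 \<longrightarrow> s + N \<ge> 0 \<and> t + N \<ge> 0) \<and>
          (\<exists>R>0. (\<lambda>(s, t). norm (a s t) * R powr ((s + N) + (t + N))) summable_on UNIV))"

text \<open>
  \<open>z\<^sup>s \<zbar>\<^sup>t\<close> for \<open>z \<noteq> 0\<close> and \<open>s - t \<in> \<int>\<close>, that is, \<open>(z \<zbar>)\<^sup>t z\<^bsup>s - t\<^esup>\<close>. Here \<^term>\<open>norm z\<close> is the usual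
  absolute value, the square root of \<open>z \<zbar>\<close>.
\<close>

definition zpow :: "complex \<Rightarrow> real \<Rightarrow> real \<Rightarrow> complex" where
  "zpow z s t = of_real (norm z powr (2 * t)) * z powi \<lfloor>s - t\<rfloor>"

section \<open>Functions with conformal singularities\<close>

text \<open>The Riemann sphere: \<^const>\<open>None\<close> is the point at infinity.\<close>

type_synonym cp1 = "complex option"

definition cp1_at_infinity :: "complex \<Rightarrow> cp1" where
  "cp1_at_infinity w = (if w = 0 then None else Some (1 / w))"

definition cp1_open :: "cp1 set \<Rightarrow> bool" where
  "cp1_open U \<longleftrightarrow> open (Some -` U) \<and> open (cp1_at_infinity -` U)"

definition cp1_holomorphic_on :: "(cp1 \<Rightarrow> complex) \<Rightarrow> cp1 set \<Rightarrow> bool" where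
  "cp1_holomorphic_on \<phi> U \<longleftrightarrow>
     (\<lambda>z. \<phi> (Some z)) holomorphic_on (Some -` U) \<and>
     (\<lambda>w. \<phi> (cp1_at_infinity w)) holomorphic_on (cp1_at_infinity -` U)"

text \<open>
  A chart at \<open>\<alpha>\<close> is a map \<open>\<phi>\<close> together with its domain \<open>U\<close>. An injective holomorphic map on an open
  set has open image and holomorphic inverse.
\<close>

definition chart_at :: "cp1 \<Rightarrow> cp1 set \<Rightarrow> (cp1 \<Rightarrow> complex) \<Rightarrow> bool" where
  "chart_at \<alpha> U \<phi> \<longleftrightarrow>
     cp1_open U \<and> \<alpha> \<in> U \<and> cp1_holomorphic_on \<phi> U \<and> inj_on \<phi> U \<and> \<phi> \<alpha> = 0"

definition is_expansion :: "cp1 set \<Rightarrow> (cp1 \<Rightarrow> complex) \<Rightarrow> (cp1 \<Rightarrow> complex) \<Rightarrow> complex series \<Rightarrow> bool" where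
  "is_expansion U \<phi> f a \<longleftrightarrow> laurent_series a \<and> abs_conv_at_0 a \<and>
     (\<exists>r>0. ball 0 r \<subseteq> \<phi> ` U \<and>
        (\<forall>z. 0 < norm z \<and> norm z < r \<longrightarrow>
           ((\<lambda>(s, t). a s t * zpow z s t) has_sum f (inv_into U \<phi> z)) UNIV))"

definition real_analytic_on :: "complex set \<Rightarrow> (complex \<Rightarrow> complex) \<Rightarrow> bool" where
  "real_analytic_on S f \<longleftrightarrow>
     (\<forall>p\<in>S. \<exists>c :: nat \<Rightarrow> nat \<Rightarrow> complex. \<exists>r>0. \<forall>z\<in>ball p r.
        ((\<lambda>(m, n). c m n * of_real (Re (z - p)) ^ m * of_real (Im (z - p)) ^ n)
           has_sum f z) UNIV)"

text \<open>The values of \<open>f\<close> at the three points \<open>0\<close>, \<open>1\<close>, \<open>\<infinity>\<close> themselves are irrelevant.\<close>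

definition F_01inf :: "(cp1 \<Rightarrow> complex) set" where
  "F_01inf = {f. real_analytic_on (- {0, 1}) (f \<circ> Some) \<and>
     (\<forall>\<alpha>\<in>{Some 0, Some 1, None}. \<forall>U \<phi>. chart_at \<alpha> U \<phi> \<longrightarrow> (\<exists>a. is_expansion U \<phi> f a))}"

definition j_series :: "cp1 set \<Rightarrow> (cp1 \<Rightarrow> complex) \<Rightarrow> (cp1 \<Rightarrow> complex) \<Rightarrow> complex series" where
  "j_series U \<phi> f = (THE a. is_expansion U \<phi> f a)"

text \<open>\<open>j(z, f)\<close>, \<open>j(z\<inverse>, f)\<close> and \<open>j(1 - z\<inverse>, f)\<close>, with \<open>\<infinity>\<inverse> = 0\<close>.\<close>

definition coord :: "cp1 \<Rightarrow> complex" where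
  "coord p = (case p of Some z \<Rightarrow> z | None \<Rightarrow> 0)"

definition coord_inverse :: "cp1 \<Rightarrow> complex" where
  "coord_inverse p = (case p of Some z \<Rightarrow> inverse z | None \<Rightarrow> 0)"

definition j_0 :: "(cp1 \<Rightarrow> complex) \<Rightarrow> complex series" where
  "j_0 f = j_series (- {None}) coord f"

definition j_inf :: "(cp1 \<Rightarrow> complex) \<Rightarrow> complex series" where
  "j_inf f = j_series (- {Some 0}) coord_inverse f"

definition j_1 :: "(cp1 \<Rightarrow> complex) \<Rightarrow> complex series" where
  "j_1 f = j_series (- {Some 0}) (\<lambda>p. 1 - coord_inverse p) f"

section \<open>Generalized two-point correlation functions\<close>

definition Y2 :: "(complex \<times> complex) set" where
  "Y2 = {(z1, z2). z1 \<noteq> z2 \<and> z1 \<noteq> 0 \<and> z2 \<noteq> 0}"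

text \<open>
  A finite list of triples \<open>(\<alpha>, \<beta>, f)\<close> presents the function
  \<open>\<Sum> z\<^sub>1\<^sup>\<alpha> \<zbar>\<^sub>1\<^sup>\<beta> f(z\<^sub>2 / z\<^sub>1)\<close>; scalar coefficients are absorbed in \<open>f\<close>.
\<close>

type_synonym gcor_presentation = "(real \<times> real \<times> (cp1 \<Rightarrow> complex)) list"

definition presents :: "gcor_presentation \<Rightarrow> (complex \<times> complex \<Rightarrow> complex) \<Rightarrow> bool" where
  "presents ts \<mu> \<longleftrightarrow>
     (\<forall>(\<alpha>, \<beta>, f) \<in> set ts. \<alpha> - \<beta> \<in> \<int> \<and> f \<in> F_01inf) \<and>
     (\<forall>(z1, z2) \<in> Y2. \<mu> (z1, z2) = (\<Sum>(\<alpha>, \<beta>, f)\<leftarrow>ts. zpow z1 \<alpha> \<beta> * f (Some (z2 / z1))))"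

definition GCor2 :: "(complex \<times> complex \<Rightarrow> complex) set" where
  "GCor2 = {\<mu>. \<exists>ts. presents ts \<mu>}"

text \<open>
  Series in two variables: \<open>S p p' q q'\<close> is the coefficient of \<open>x\<^sup>p x\<bar>\<^bsup>p'\<^esup> y\<^sup>q y\<bar>\<^bsup>q'\<^esup>\<close>, where
  \<open>(x, y)\<close> is \<open>(z\<^sub>1, z\<^sub>2)\<close> in the first two expansions and \<open>(z\<^sub>0, z\<^sub>2)\<close>, \<open>z\<^sub>0 = z\<^sub>1 - z\<^sub>2\<close>, in the third.
  The expansions of an element of \<^const>\<open>GCor2\<close> do not depend on the presentation.
\<close>

type_synonym series2 = "real \<Rightarrow> real \<Rightarrow> real \<Rightarrow> real \<Rightarrow> complex"

text \<open>\<open>|z\<^sub>1| > |z\<^sub>2|\<close>: a term \<open>a s t\<close> of \<open>j(z, f)\<close> contributes to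
  \<open>z\<^sub>1\<^bsup>\<alpha> - s\<^esup> \<zbar>\<^sub>1\<^bsup>\<beta> - t\<^esup> z\<^sub>2\<^sup>s \<zbar>\<^sub>2\<^sup>t\<close>.\<close>

definition expand_1_2 :: "gcor_presentation \<Rightarrow> series2" where
  "expand_1_2 ts p p' q q' =
     (\<Sum>(\<alpha>, \<beta>, f)\<leftarrow>ts. if p + q = \<alpha> \<and> p' + q' = \<beta> then j_0 f q q' else 0)"

text \<open>\<open>|z\<^sub>2| > |z\<^sub>1|\<close>: a term \<open>a s t\<close> of \<open>j(z\<inverse>, f)\<close> contributes to
  \<open>z\<^sub>1\<^bsup>\<alpha> + s\<^esup> \<zbar>\<^sub>1\<^bsup>\<beta> + t\<^esup> z\<^sub>2\<^bsup>- s\<^esup> \<zbar>\<^sub>2\<^bsup>- t\<^esup>\<close>.\<close>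

definition expand_2_1 :: "gcor_presentation \<Rightarrow> series2" where
  "expand_2_1 ts p p' q q' =
     (\<Sum>(\<alpha>, \<beta>, f)\<leftarrow>ts. if p + q = \<alpha> \<and> p' + q' = \<beta> then j_inf f (- q) (- q') else 0)"

text \<open>\<open>|z\<^sub>2| > |z\<^sub>1 - z\<^sub>2|\<close>: a term \<open>a s t\<close> of \<open>j(1 - z\<inverse>, f)\<close> and the \<open>i\<close>-th and \<open>k\<close>-th terms of the
  binomial series contribute to
  \<open>z\<^sub>0\<^bsup>s + i\<^esup> \<zbar>\<^sub>0\<^bsup>t + k\<^esup> z\<^sub>2\<^bsup>\<alpha> - s - i\<^esup> \<zbar>\<^sub>2\<^bsup>\<beta> - t - k\<^esup>\<close>. Only finitely many \<open>(i, k)\<close> contribute to a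
  given monomial since the exponents in \<open>j(1 - z\<inverse>, f)\<close> are bounded below.\<close>

definition expand_2_0 :: "gcor_presentation \<Rightarrow> series2" where
  "expand_2_0 ts p p' q q' =
     (\<Sum>(\<alpha>, \<beta>, f)\<leftarrow>ts. if p + q = \<alpha> \<and> p' + q' = \<beta> then
        (\<Sum>(i, k) | j_1 f (p - real i) (p' - real k) \<noteq> 0.
           of_real (\<alpha> gchoose i) * of_real (\<beta> gchoose k) *
           (-1) powi \<lfloor>(p - real i) - (p' - real k)\<rfloor> * j_1 f (p - real i) (p' - real k))
      else 0)"

section \<open>Full vertex algebras\<close>

text \<open>\<^term>\<open>mode F a r s b\<close> is \<open>a(r,s)b\<close>, where \<open>Y(a, z) = \<Sum> a(r,s) z\<^bsup>-r-1\<^esup> \<zbar>\<^bsup>-s-1\<^esup>\<close>.\<close>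

record 'a fva_data =
  fspace :: "'a set"
  grade :: "real \<Rightarrow> real \<Rightarrow> 'a set"
  mode :: "'a \<Rightarrow> real \<Rightarrow> real \<Rightarrow> 'a \<Rightarrow> 'a"
  vacuum :: 'a

definition vertex_op :: "'a fva_data \<Rightarrow> 'a \<Rightarrow> 'a \<Rightarrow> 'a series" where
  "vertex_op F a b p q = mode F a (- p - 1) (- q - 1) b"

definition restricted_dual :: "'a::complex_vector fva_data \<Rightarrow> ('a \<Rightarrow> complex) set" where
  "restricted_dual F =
     {u. linear_on (fspace F) u \<and> finite {(h, h'). \<exists>v\<in>grade F h h'. u v \<noteq> 0}}"

locale full_vertex_algebra =
  fixes F :: "'a::complex_vector fva_data"
  assumes grading: "is_direct_sum (fspace F) (\<lambda>(h, h'). grade F h h')"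
    and vacuum_grade: "vacuum F \<in> grade F 0 0"
    and mode_closed: "\<lbrakk>a \<in> fspace F; b \<in> fspace F\<rbrakk> \<Longrightarrow> mode F a r s b \<in> fspace F"
    and mode_bilinear: "bilinear_on (fspace F) (fspace F) (\<lambda>a b. mode F a r s b)"
    and mode_integral: "\<lbrakk>a \<in> fspace F; b \<in> fspace F; r - s \<notin> \<int>\<rbrakk> \<Longrightarrow> mode F a r s b = 0"
    and FV1: "\<lbrakk>a \<in> fspace F; b \<in> fspace F\<rbrakk> \<Longrightarrow> laurent_series (vertex_op F a b)"
    and FV2: "h - h' \<notin> \<int> \<Longrightarrow> grade F h h' = {0}"
    and FV3: "a \<in> fspace F \<Longrightarrow>
      power_series (vertex_op F a (vacuum F)) \<and> mode F a (-1) (-1) (vacuum F) = a"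
    and FV4: "b \<in> fspace F \<Longrightarrow>
      mode F (vacuum F) r s b = (if r = -1 \<and> s = -1 then b else 0)"
    and FV5: "\<lbrakk>a \<in> fspace F; b \<in> fspace F; c \<in> fspace F; u \<in> restricted_dual F\<rbrakk> \<Longrightarrow>
      \<exists>\<mu>\<in>GCor2. \<exists>ts. presents ts \<mu> \<and>
        (\<forall>p p' q q'.
          u (vertex_op F a (vertex_op F b c q q') p p') = expand_1_2 ts p p' q q' \<and>
          u (vertex_op F (vertex_op F a b p p') c q q') = expand_2_0 ts p p' q q' \<and>
          u (vertex_op F b (vertex_op F a c p p') q q') = expand_2_1 ts p p' q q')"
    and FV6: "\<lbrakk>a \<in> grade F h h'; b \<in> grade F k k'\<rbrakk> \<Longrightarrow>
      mode F a r s b \<in> grade F (h + k - r - 1) (h' + k' - s - 1)"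

definition D_op :: "'a fva_data \<Rightarrow> 'a \<Rightarrow> 'a" where
  "D_op F a = mode F a (-2) (-1) (vacuum F)"

definition Dbar_op :: "'a fva_data \<Rightarrow> 'a \<Rightarrow> 'a" where
  "Dbar_op F a = mode F a (-1) (-2) (vacuum F)"

definition subalgebra_on :: "'a fva_data \<Rightarrow> 'a set \<Rightarrow> 'a fva_data" where
  "subalgebra_on F K = \<lparr>fspace = K, grade = (\<lambda>h h'. grade F h h' \<inter> K),
     mode = mode F, vacuum = vacuum F\<rparr>"

definition ker_D :: "'a::complex_vector fva_data \<Rightarrow> 'a fva_data" where
  "ker_D F = subalgebra_on F {a \<in> fspace F. D_op F a = 0}"

definition ker_Dbar :: "'a::complex_vector fva_data \<Rightarrow> 'a fva_data" where
  "ker_Dbar F = subalgebra_on F {a \<in> fspace F. Dbar_op F a = 0}"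

definition spectrum_bounded_below :: "'a::complex_vector fva_data \<Rightarrow> bool" where
  "spectrum_bounded_below F \<longleftrightarrow> (\<exists>N. \<forall>h h'. h \<le> N \<or> h' \<le> N \<longrightarrow> grade F h h' = {0})"

definition spectrum_discrete :: "'a::complex_vector fva_data \<Rightarrow> bool" where
  "spectrum_discrete F \<longleftrightarrow>
     (\<forall>K. (\<Sum>\<^sub>\<infinity>(h, h') | h + h' < K. edim (grade F h h')) < \<infinity>)"

text \<open>
  The coefficientwise reading of \<open>Y(a \<otimes> b, z) (c \<otimes> d) = Y(a, z) c \<otimes> Y(b, z) d\<close> is
  \<open>(a \<otimes> b)(r,s) (c \<otimes> d) = \<Sum> a(r\<^sub>1,s\<^sub>1) c \<otimes> b(r\<^sub>2,s\<^sub>2) d\<close> over \<open>r\<^sub>1 + r\<^sub>2 = r - 1\<close> and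
  \<open>s\<^sub>1 + s\<^sub>2 = s - 1\<close>. Only finitely many terms are nonzero, by the axiom \<open>FV1\<close> of the two factors.
\<close>

definition tensor_mode_pure ::
  "'a::complex_vector fva_data \<Rightarrow> 'b::complex_vector fva_data \<Rightarrow> real \<Rightarrow> real \<Rightarrow>
   'a \<Rightarrow> 'b \<Rightarrow> 'a \<Rightarrow> 'b \<Rightarrow> ('a, 'b) tensor" where
  "tensor_mode_pure F1 F2 r s a b c d =
     (\<Sum>(r1, s1) | mode F1 a r1 s1 c \<otimes> mode F2 b (r - 1 - r1) (s - 1 - s1) d \<noteq> 0.
        mode F1 a r1 s1 c \<otimes> mode F2 b (r - 1 - r1) (s - 1 - s1) d)"

definition tensor_fva ::
  "'a::complex_vector fva_data \<Rightarrow> 'b::complex_vector fva_data \<Rightarrow> ('a, 'b) tensor fva_data" where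
  "tensor_fva F1 F2 =
     \<lparr>fspace = tensor_space (fspace F1) (fspace F2),
      grade = (\<lambda>h h'. cvs.span {a \<otimes> b | a b.
        \<exists>h1 h1'. a \<in> grade F1 h1 h1' \<and> b \<in> grade F2 (h - h1) (h' - h1')}),
      mode = (\<lambda>x r s y.
        tensor_lift (fspace F1) (fspace F2) (\<lambda>a b.
          tensor_lift (fspace F1) (fspace F2) (\<lambda>c d. tensor_mode_pure F1 F2 r s a b c d) y) x),
      vacuum = vacuum F1 \<otimes> vacuum F2\<rparr>"

definition fva_hom ::
  "'a::complex_vector fva_data \<Rightarrow> 'b::complex_vector fva_data \<Rightarrow> ('a \<Rightarrow> 'b) \<Rightarrow> bool" where
  "fva_hom F1 F2 f \<longleftrightarrow>
     linear_on (fspace F1) f \<and> f ` fspace F1 \<subseteq> fspace F2 \<and> f (vacuum F1) = vacuum F2 \<and>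
     (\<forall>a\<in>fspace F1. \<forall>b\<in>fspace F1. \<forall>r s. f (mode F1 a r s b) = mode F2 (f a) r s (f b))"

definition t_map :: "'a::complex_vector fva_data \<Rightarrow> ('a, 'a) tensor \<Rightarrow> 'a" where
  "t_map F = tensor_lift (fspace (ker_Dbar F)) (fspace (ker_D F)) (\<lambda>a b. mode F a (-1) (-1) b)"

lemma (in full_vertex_algebra) t_map_pure:
  assumes "a \<in> fspace (ker_Dbar F)" "b \<in> fspace (ker_D F)"
  shows "t_map F (a \<otimes> b) = mode F a (-1) (-1) b"
proof -
  have V: "cvs.subspace (fspace F)"
    using grading by (simp add: is_direct_sum_def)
  have vac: "vacuum F \<in> fspace F"
    using grading vacuum_grade by (force simp: is_direct_sum_def)
  have "linear_on (fspace F) (\<lambda>a. mode F a r s (vacuum F))" for r s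
    using mode_bilinear[of r s] vac by (simp add: bilinear_on_def)
  then have K: "cvs.subspace {a \<in> fspace F. mode F a r s (vacuum F) = 0}" for r s
    using V cvs.scale_eq_0_iff[of 0 "vacuum F"]
    by (auto simp: cvs.subspace_def linear_on_def) (metis cvs.scale_zero_left)
  have "cvs.subspace (fspace (ker_Dbar F))" "cvs.subspace (fspace (ker_D F))"
    using K[of "-1" "-2"] K[of "-2" "-1"]
    by (simp_all add: ker_Dbar_def ker_D_def subalgebra_on_def Dbar_op_def D_op_def)
  moreover have "bilinear_on (fspace (ker_Dbar F)) (fspace (ker_D F)) (\<lambda>a b. mode F a (-1) (-1) b)"
    using mode_bilinear[of "-1" "-1"]
    by (auto simp: bilinear_on_def linear_on_def ker_Dbar_def ker_D_def subalgebra_on_def)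
  ultimately show ?thesis
    unfolding t_map_def using assms by (rule tensor_lift_pure(2))
qed

end

theory Submission
  imports Defs
begin

text \<open>
  Write \<open>a\<^sub>p\<^sub>qb\<close> for the coefficient of \<open>z\<^sup>p \<zbar>\<^sup>q\<close> in \<open>Y(a, z)b\<close>. The theorem reduces to one identity: for
  \<open>a\<close>, \<open>c\<close> in \<open>ker Dbar\<close> and \<open>b\<close>, \<open>d\<close> in \<open>ker D\<close>,
  \<open>(a\<^sub>0\<^sub>0b)\<^sub>p\<^sub>q(c\<^sub>0\<^sub>0d) = (a\<^sub>p\<^sub>0c)\<^sub>0\<^sub>0(b\<^sub>0\<^sub>qd)\<close> (\<open>chiral_product_multiplicative\<close>). Instead of
  Borcherds identities, which rest on the poles of general meromorphic correlation functions, the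
  proof uses only correlation functions whose expansion at \<open>0\<close> has at most one term; such a function
  is known on the whole sphere.

  The axiom of two-point functions compares \<open>Y(a)Y(b)c\<close>, \<open>Y(Y(a)b)c\<close> and \<open>Y(b)Y(a)c\<close>: for each pair
  \<open>(\<alpha>, \<beta>)\<close> of total exponents there is one function \<open>f\<close> on the sphere minus \<open>0\<close>, \<open>1\<close>, \<open>\<infinity>\<close> whose
  expansions at these points are the matrix coefficients of the three compositions
  (\<open>correlation_function\<close>). If the expansion at \<open>0\<close> is the one term \<open>C \<zbar>\<^sup>n\<close> with an integer \<open>n\<close>,
  then \<open>f = C \<zbar>\<^sup>n\<close> near \<open>0\<close>, hence everywhere by the identity theorem for real analytic functions,
  and the expansions at \<open>\<infinity>\<close> and \<open>1\<close> can be read off (\<open>j_inf_antiholomorphic\<close>,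
  \<open>j_1_antiholomorphic\<close>, \<open>j_1_constant\<close>). This is used for three choices of vectors.

  \<^item> With the vacuum in the middle, \<open>Y(a)Y(1)c\<close> does not involve the second variable, so \<open>f\<close> is a
    constant. This gives \<open>Y(D a, z) = dY(a, z)/dz\<close> and \<open>Y(Dbar a, z) = dY(a, z)/d\<zbar>\<close>
    (\<open>vertex_op_derivative\<close>), so fields from \<open>ker Dbar\<close> contain no powers of \<open>\<zbar>\<close> and fields from
    \<open>ker D\<close> no powers of \<open>z\<close>.
  \<^item> For \<open>a\<close>, \<open>c\<close> in \<open>ker Dbar\<close> the product \<open>Y(a)Y(c)1\<close> contains no antiholomorphic powers, so
    the component of antiholomorphic degree \<open>1\<close> is \<open>f = 0\<close>; but \<open>Dbar (a\<^sub>p\<^sub>0c)\<close> is read off from this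
    component. Hence \<open>ker Dbar\<close>, and likewise \<open>ker D\<close>, is closed under all modes.
  \<^item> For \<open>a\<close> in \<open>ker Dbar\<close> and \<open>b\<close> in \<open>ker D\<close> the product \<open>Y(a, z\<^sub>1)Y(b, z\<^sub>2)c\<close> contains only
    \<open>z\<^sub>1\<^sup>p\<zbar>\<^sub>2\<^sup>q\<close>, so \<open>f\<close> is a multiple of \<open>\<zbar>\<^sup>q\<close>. Hence the modes of \<open>a\<close> and \<open>b\<close> commute and
    their product is the corresponding mode of \<open>a\<^sub>0\<^sub>0b\<close> (\<open>chiral_product\<close>).

  Commutation applied to the vacuum gives \<open>c\<^sub>0\<^sub>0d = d\<^sub>0\<^sub>0c\<close>, and the identity follows by moving modes past
  each other. On the tensor side, the sum that defines a mode of \<open>a \<otimes> b\<close> on \<open>c \<otimes> d\<close> has the single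
  term \<open>a\<^sub>p\<^sub>0c \<otimes> b\<^sub>0\<^sub>qd\<close>, which \<open>t\<close> maps to the right-hand side.
\<close>

section \<open>The identity theorem for real analytic functions\<close>

text \<open>
  A real power series in two variables converges absolutely at every point where its sum is defined,
  so along a line parallel to an axis the real coordinate may be replaced by a complex number of the
  same size. This extends the restriction to the line to a holomorphic function.
\<close>

lemma slice_holomorphic:
  fixes c :: "nat \<Rightarrow> nat \<Rightarrow> complex" and Y :: complex
  assumes S: "\<And>x::real. \<bar>x\<bar> < \<rho> \<Longrightarrow>
     ((\<lambda>(m, n). c m n * of_real x ^ m * Y ^ n) has_sum F x) UNIV"
  obtains H where "H holomorphic_on ball 0 \<rho>" "\<And>x::real. \<bar>x\<bar> < \<rho> \<Longrightarrow> H (of_real x) = F x"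
proof -
  define T where "T X = (\<lambda>(m, n). c m n * X ^ m * Y ^ n)" for X
  define A where "A m = (\<Sum>\<^sub>\<infinity>n. c m n * Y ^ n)" for m
  have summ: "T X summable_on UNIV" if "norm X < \<rho>" for X
  proof -
    have "(\<lambda>x. norm (T (of_real (norm X)) x)) summable_on UNIV"
      using S[of "norm X"] that unfolding T_def
      by (subst summable_on_iff_abs_summable_on_complex[symmetric])
         (auto simp: has_sum_imp_summable)
    moreover have "(\<lambda>x. norm (T (of_real (norm X)) x)) = (\<lambda>x. norm (T X x))"
      by (auto simp: T_def fun_eq_iff norm_mult norm_power)
    ultimately have "(\<lambda>x. norm (T X x)) summable_on UNIV" by simp
    then show ?thesis by (simp add: summable_on_iff_abs_summable_on_complex)
  qed
  have hs: "((\<lambda>m. A m * X ^ m) has_sum infsum (T X) UNIV) UNIV" if "norm X < \<rho>" for X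
  proof -
    have s: "(\<lambda>(m, n). T X (m, n)) summable_on Sigma UNIV (\<lambda>_. UNIV)"
      using summ[OF that] by simp
    have "(\<Sum>\<^sub>\<infinity>n. T X (m, n)) = A m * X ^ m" for m
      unfolding T_def A_def
      by (simp add: infsum_cmult_right'[symmetric] mult.commute mult.left_commute)
    then show ?thesis
      using infsum_Sigma'_banach[OF s] summable_on_Sigma_banach[OF s]
      by (simp add: has_sum_iff)
  qed
  have "(\<lambda>X. infsum (T X) UNIV) holomorphic_on ball 0 \<rho>"
    by (rule power_series_holomorphic[where a = A])
       (use hs in \<open>auto intro!: has_sum_imp_sums\<close>)
  moreover have "infsum (T (of_real x)) UNIV = F x" if "\<bar>x\<bar> < \<rho>" for x
    using S[OF that] by (auto simp: T_def infsumI)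
  ultimately show ?thesis using that by blast
qed

lemma holomorphic_eq_on_reals:
  fixes q :: real
  assumes "H holomorphic_on ball 0 \<rho>" "G holomorphic_on ball 0 \<rho>"
    and q: "\<bar>q\<bar> < \<rho>" and "e > 0"
    and eq: "\<And>x::real. \<bar>x\<bar> < \<rho> \<Longrightarrow> \<bar>x - q\<bar> < e \<Longrightarrow> H (of_real x) = G (of_real x)"
    and x: "\<bar>x\<bar> < \<rho>"
  shows "H (of_real x) = G (of_real x)"
proof -
  define U where "U = (of_real :: real \<Rightarrow> complex) ` {x. \<bar>x\<bar> < \<rho> \<and> \<bar>x - q\<bar> < e}"
  have "q islimpt {x. \<bar>x\<bar> < \<rho> \<and> \<bar>x - q\<bar> < e}"
  proof -
    have "open ({-\<rho><..<\<rho>} \<inter> {q-e<..<q+e})" by (intro open_Int) auto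
    moreover have "{-\<rho><..<\<rho>} \<inter> {q-e<..<q+e} = {x. \<bar>x\<bar> < \<rho> \<and> \<bar>x - q\<bar> < e}"
      by (auto simp: abs_less_iff)
    ultimately show ?thesis
      using q \<open>e > 0\<close> by (intro interior_limit_point) (metis (mono_tags, lifting) abs_zero diff_self interior_open mem_Collect_eq)
  qed
  then have lim: "of_real q islimpt U"
    unfolding U_def
    by (intro islimpt_isCont_image) (auto simp: eventually_at_filter)
  have zero: "H z - G z = 0" if "z \<in> U" for z
    using that eq by (auto simp: U_def)
  have "(\<lambda>z. H z - G z) holomorphic_on ball 0 \<rho>"
    using assms(1,2) by (rule holomorphic_on_diff)
  then have "H (of_real x) - G (of_real x) = 0"
  proof (rule analytic_continuation[OF _ _ _ _ _ lim zero])
    show "U \<subseteq> ball 0 \<rho>" by (auto simp: U_def)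
  qed (use q x in auto)
  then show ?thesis by simp
qed

text \<open>
  Local agreement propagates from one point of a small disc to the whole disc, and so through a
  connected set. Within the disc, write \<open>z = p + x + \<i>y\<close> and extend both functions holomorphically in
  \<open>x\<close> alone: agreement for \<open>x\<close> near \<open>q\<^sub>1\<close> spreads to the strip of all \<open>x\<close>, with \<open>y\<close> still near \<open>q\<^sub>2\<close>.
  The same argument in \<open>y\<close> then spreads it to the square around \<open>p\<close>.
\<close>

theorem real_analytic_eq_holomorphic:
  assumes S: "open S" "connected S"
    and f: "real_analytic_on S f" and g: "g holomorphic_on S"
    and a: "a \<in> S" and "e > 0" and near: "\<And>z. z \<in> ball a e \<Longrightarrow> f z = g z"
    and b: "b \<in> S"
  shows "f b = g b"
proof -
  define P where "P x \<longleftrightarrow> (\<exists>e>0. \<forall>z\<in>ball x e. f z = g z)" for x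
  have "P b"
  proof (rule connected_induction_simple[where P = P and S = S and a = a and b = b])
    show "P a" using \<open>e > 0\<close> near unfolding P_def by blast
    fix p assume p: "p \<in> S"
    obtain c r where r: "r > 0" and hs: "\<And>z. z \<in> ball p r \<Longrightarrow>
        ((\<lambda>(m, n). c m n * of_real (Re (z - p)) ^ m * of_real (Im (z - p)) ^ n) has_sum f z) UNIV"
      using f p unfolding real_analytic_on_def by blast
    obtain r' where r': "r' > 0" "ball p r' \<subseteq> S"
      using S p open_contains_ball by blast
    \<comment> \<open>Halving makes \<open>p + X + \<i>Y\<close> stay in both balls for complex \<open>X\<close>, \<open>Y\<close> of norm less than \<open>\<rho>\<close>.\<close>
    define \<rho> where "\<rho> = min r r' / 2"
    have \<rho>: "\<rho> > 0" using r r' by (simp add: \<rho>_def)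
    have in_ball: "p + (X + \<i> * Y) \<in> ball p r \<and> p + (X + \<i> * Y) \<in> S"
      if "norm X < \<rho>" "norm Y < \<rho>" for X Y :: complex
    proof -
      have "norm (X + \<i> * Y) \<le> norm X + norm Y"
        using norm_triangle_ineq[of X "\<i> * Y"] by (simp add: norm_mult)
      then have "norm (X + \<i> * Y) < 2 * \<rho>" using that by linarith
      moreover have "dist p (p + V) = norm V" for V :: complex
        by (simp add: dist_norm)
      ultimately have "dist p (p + (X + \<i> * Y)) < r" "dist p (p + (X + \<i> * Y)) < r'"
        by (auto simp: \<rho>_def)
      then show ?thesis using r' by auto
    qed
    define h where "h x y = f (p + (of_real x + \<i> * of_real y))" for x y :: real
    have h: "((\<lambda>(m, n). c m n * of_real x ^ m * of_real y ^ n) has_sum h x y) UNIV"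
      if "\<bar>x\<bar> < \<rho>" "\<bar>y\<bar> < \<rho>" for x y :: real
    proof -
      have "p + (of_real x + \<i> * of_real y) \<in> ball p r"
        using in_ball[of "of_real x" "of_real y"] that by simp
      from hs[OF this] show ?thesis by (simp add: h_def)
    qed
    have key: "\<forall>z\<in>ball p \<rho>. f z = g z" if q: "q \<in> ball p \<rho>" and "P q" for q
    proof -
      obtain e where e: "e > 0" "\<And>z. z \<in> ball q e \<Longrightarrow> f z = g z"
        using \<open>P q\<close> unfolding P_def by blast
      define q1 q2 where "q1 = Re (q - p)" and "q2 = Im (q - p)"
      have q12: "\<bar>q1\<bar> < \<rho>" "\<bar>q2\<bar> < \<rho>"
        using q abs_Re_le_cmod[of "q - p"] abs_Im_le_cmod[of "q - p"]
        by (auto simp: q1_def q2_def dist_norm norm_minus_commute)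
      have q_eq: "q = p + (of_real q1 + \<i> * of_real q2)"
        by (simp add: q1_def q2_def complex_eq_iff)
      have near_q: "h x y = g (p + (of_real x + \<i> * of_real y))"
        if "\<bar>x - q1\<bar> < e / 2" "\<bar>y - q2\<bar> < e / 2" for x y
      proof -
        have "norm (of_real (x - q1) + \<i> * of_real (y - q2)) \<le> \<bar>x - q1\<bar> + \<bar>y - q2\<bar>"
          using norm_triangle_ineq[of "of_real (x - q1)" "\<i> * of_real (y - q2)"]
          by (simp add: norm_mult del: of_real_diff)
        then have "norm (of_real (x - q1) + \<i> * of_real (y - q2)) < e"
          using that by linarith
        moreover have "p + (of_real x + \<i> * of_real y) - q = of_real (x - q1) + \<i> * of_real (y - q2)"
          by (simp add: q_eq algebra_simps)
        ultimately have "p + (of_real x + \<i> * of_real y) \<in> ball q e"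
          by (metis dist_norm dist_commute mem_ball)
        then show ?thesis unfolding h_def by (rule e)
      qed
      have gx: "(\<lambda>X. g (p + (X + \<i> * of_real y))) holomorphic_on ball 0 \<rho>" if "\<bar>y\<bar> < \<rho>" for y
        using in_ball that
        by (intro holomorphic_on_compose_gen[OF _ g, unfolded o_def] holomorphic_intros) auto
      have gy: "(\<lambda>Y. g (p + (of_real x + \<i> * Y))) holomorphic_on ball 0 \<rho>" if "\<bar>x\<bar> < \<rho>" for x
        using in_ball that
        by (intro holomorphic_on_compose_gen[OF _ g, unfolded o_def] holomorphic_intros) auto
      have strip: "h x y = g (p + (of_real x + \<i> * of_real y))"
        if x: "\<bar>x\<bar> < \<rho>" and y: "\<bar>y\<bar> < \<rho>" "\<bar>y - q2\<bar> < e / 2" for x y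
      proof -
        obtain H where H: "H holomorphic_on ball 0 \<rho>" "\<And>x::real. \<bar>x\<bar> < \<rho> \<Longrightarrow> H (of_real x) = h x y"
          using slice_holomorphic[of \<rho> c "of_real y" "\<lambda>x. h x y"] h y by blast
        have "H (of_real x) = g (p + (of_real x + \<i> * of_real y))"
          by (rule holomorphic_eq_on_reals[OF H(1) gx[OF y(1)] q12(1), of "e / 2"])
             (use e x y near_q H in auto)
        then show ?thesis using H x by simp
      qed
      have square: "h x y = g (p + (of_real x + \<i> * of_real y))"
        if x: "\<bar>x\<bar> < \<rho>" and y: "\<bar>y\<bar> < \<rho>" for x y
      proof -
        have "((\<lambda>(n, m). c m n * of_real y ^ n * of_real x ^ m) has_sum h x y) UNIV"
          if "\<bar>y\<bar> < \<rho>" for y :: real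
        proof -
          have "((\<lambda>(n, m). c m n * of_real x ^ m * of_real y ^ n) has_sum h x y) UNIV"
            using h[OF x that] has_sum_reindex[of prod.swap UNIV "\<lambda>(n, m). c m n * of_real x ^ m * of_real y ^ n"]
            by (simp add: o_def case_prod_unfold)
          then show ?thesis by (simp add: mult_ac)
        qed
        then obtain H where H: "H holomorphic_on ball 0 \<rho>" "\<And>y::real. \<bar>y\<bar> < \<rho> \<Longrightarrow> H (of_real y) = h x y"
          using slice_holomorphic[of \<rho> "\<lambda>n m. c m n" "of_real x" "\<lambda>y. h x y"] by blast
        have "H (of_real y) = g (p + (of_real x + \<i> * of_real y))"
          by (rule holomorphic_eq_on_reals[OF H(1) gy[OF x] q12(2), of "e / 2"])
             (use e x y strip H in auto)
        then show ?thesis using H y by simp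
      qed
      show ?thesis
      proof
        fix z assume z: "z \<in> ball p \<rho>"
        have "\<bar>Re (z - p)\<bar> < \<rho>" "\<bar>Im (z - p)\<bar> < \<rho>"
          using z abs_Re_le_cmod[of "z - p"] abs_Im_le_cmod[of "z - p"]
          by (auto simp: dist_norm norm_minus_commute)
        moreover have "z = p + (of_real (Re (z - p)) + \<i> * of_real (Im (z - p)))"
          by (simp add: complex_eq_iff)
        ultimately show "f z = g z" using square unfolding h_def by metis
      qed
    qed
    have "\<forall>x\<in>S \<inter> ball p \<rho>. \<forall>y\<in>S \<inter> ball p \<rho>. P x \<longrightarrow> P y"
    proof (intro ballI impI)
      fix x y assume x: "x \<in> S \<inter> ball p \<rho>" and y: "y \<in> S \<inter> ball p \<rho>" and "P x"
      obtain d where "d > 0" "ball y d \<subseteq> ball p \<rho>"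
        using y open_contains_ball[of "ball p \<rho>"] open_ball by blast
      then show "P y" using key[of x] x \<open>P x\<close> unfolding P_def by blast
    qed
    then show "\<exists>T. openin (top_of_set S) T \<and> p \<in> T \<and> (\<forall>x\<in>T. \<forall>y\<in>T. P x \<longrightarrow> P y)"
      using p \<rho> by (intro exI[of _ "S \<inter> ball p \<rho>"]) (auto simp: openin_open_Int)
  qed (use S a b in auto)
  then show ?thesis unfolding P_def by (metis centre_in_ball)
qed

section \<open>Uniqueness of expansions\<close>

lemma of_int_floor_diff: "s - t \<in> \<int> \<Longrightarrow> real_of_int \<lfloor>s - t\<rfloor> = s - t"
  by (auto elim: Ints_cases)

lemma zpow_polar:
  assumes "\<rho> > 0" "norm w = 1" "s - t \<in> \<int>"
  shows "zpow (of_real \<rho> * w) s t = of_real (\<rho> powr (s + t)) * w powi \<lfloor>s - t\<rfloor>"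
proof -
  have "\<rho> powr (2 * t) * \<rho> powi \<lfloor>s - t\<rfloor> = \<rho> powr (2 * t) * \<rho> powr (s - t)"
    using assms of_int_floor_diff[of s t] powr_real_of_int'[of \<rho> "\<lfloor>s - t\<rfloor>"] by simp
  also have "\<dots> = \<rho> powr (s + t)"
    by (simp add: powr_add[symmetric] add.commute)
  finally have "\<rho> powr (s + t) = \<rho> powr (2 * t) * \<rho> powi \<lfloor>s - t\<rfloor>" ..
  then show ?thesis
    using assms by (simp add: zpow_def norm_mult power_int_mult_distrib)
qed

lemma norm_zpow:
  assumes "z \<noteq> 0" "s - t \<in> \<int>"
  shows "norm (zpow z s t) = norm z powr (s + t)"
proof -
  have "zpow z s t = of_real (norm z powr (s + t)) * (sgn z) powi \<lfloor>s - t\<rfloor>"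
  proof -
    have "of_real (norm z) * sgn z = z"
      using assms by (simp add: sgn_div_norm scaleR_conv_of_real)
    then show ?thesis
      using zpow_polar[of "norm z" "sgn z" s t] assms by (simp add: norm_sgn)
  qed
  then show ?thesis
    using assms by (simp add: norm_mult norm_power_int norm_sgn)
qed

text \<open>
  Multiplication by a power of \<open>w\<close> makes the sum a polynomial with infinitely many roots.
\<close>

lemma trigonometric_polynomial_zero:
  fixes c :: "int \<Rightarrow> complex"
  assumes fin: "finite S" and zero: "\<And>w. norm w = 1 \<Longrightarrow> (\<Sum>k\<in>S. c k * w powi k) = 0"
    and k: "k \<in> S"
  shows "c k = 0"
proof -
  obtain K where K: "\<And>j. j \<in> S \<Longrightarrow> j + int K \<ge> 0"
  proof -
    have "j + int (nat \<bar>Min S\<bar>) \<ge> 0" if "j \<in> S" for j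
      using Min_le[OF fin that] by linarith
    then show ?thesis using that by blast
  qed
  define p where "p = (\<Sum>j\<in>S. monom (c j) (nat (j + int K)))"
  have "poly p w = 0" if "norm w = 1" for w
  proof -
    have "c j * w ^ nat (j + int K) = c j * w powi j * w ^ K" if "j \<in> S" for j
    proof -
      have "w ^ nat (j + int K) = w powi (j + int K)"
        using K[OF that] by (simp add: power_int_def)
      also have "\<dots> = w powi j * w ^ K"
        using \<open>norm w = 1\<close> by (subst power_int_add) auto
      finally show ?thesis by simp
    qed
    then have "poly p w = (\<Sum>j\<in>S. c j * w powi j) * w ^ K"
      unfolding p_def poly_sum poly_monom sum_distrib_right by (rule sum.cong[OF refl])
    then show ?thesis using zero that by simp
  qed
  then have "sphere 0 1 \<subseteq> {w. poly p w = 0}" by auto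
  moreover have "infinite (sphere (0::complex) 1)"
  proof -
    have "1 \<in> sphere (0::complex) 1" "-1 \<in> sphere (0::complex) 1" "(1::complex) \<noteq> -1" by auto
    moreover have "connected (sphere (0::complex) 1)" by (simp add: connected_sphere)
    ultimately show ?thesis
      using connected_finite_iff_sing[of "sphere (0::complex) 1"] by (metis empty_iff singletonD)
  qed
  ultimately have "p = 0"
    using poly_roots_finite infinite_super by blast
  then have "0 = coeff p (nat (k + int K))" by simp
  also have "\<dots> = (\<Sum>j\<in>S. if j = k then c j else 0)"
    unfolding p_def coeff_sum
  proof (rule sum.cong[OF refl])
    fix j assume "j \<in> S"
    then have "nat (j + int K) = nat (k + int K) \<longleftrightarrow> j = k"
      using eq_nat_nat_iff[of "j + int K" "k + int K"] K[of j] K[OF k] by simp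
    then show "coeff (monom (c j) (nat (j + int K))) (nat (k + int K)) = (if j = k then c j else 0)"
      by (simp add: coeff_monom)
  qed
  also have "\<dots> = c k" using fin k by simp
  finally show ?thesis by simp
qed

definition converges_near_0 :: "complex series \<Rightarrow> (complex \<Rightarrow> complex) \<Rightarrow> bool" where
  "converges_near_0 a \<phi> \<longleftrightarrow>
     (\<exists>r>0. \<forall>z. 0 < norm z \<and> norm z < r \<longrightarrow> ((\<lambda>(s, t). a s t * zpow z s t) has_sum \<phi> z) UNIV)"

text \<open>
  Let \<open>m\<close> be the least total degree \<open>s + t\<close> of a nonzero term. The finitely many terms of degree \<open>m\<close>
  contribute \<open>\<rho>\<^sup>m P(w)\<close> at \<open>z = \<rho>w\<close>, \<open>|w| = 1\<close>, with a trigonometric polynomial \<open>P\<close>. Since only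
  finitely many degrees lie below any bound, the remaining degrees are at least \<open>m + \<delta>\<close> with
  \<open>\<delta> > 0\<close>, and the remaining terms sum to \<open>O(\<rho>\<^bsup>m + \<delta>\<^esup>)\<close>. Letting \<open>\<rho>\<close> tend to \<open>0\<close> gives \<open>P = 0\<close>.
\<close>

lemma laurent_series_zero:
  assumes a: "laurent_series a" and conv: "converges_near_0 a (\<lambda>_. 0)"
  shows "a s1 t1 = 0"
proof (rule ccontr)
  assume a1: "a s1 t1 \<noteq> 0"
  obtain r where r: "r > 0"
    and hs: "\<And>z. 0 < norm z \<Longrightarrow> norm z < r \<Longrightarrow> ((\<lambda>(s, t). a s t * zpow z s t) has_sum 0) UNIV"
    using conv unfolding converges_near_0_def by blast
  have integral: "s - t \<in> \<int>" if "a s t \<noteq> 0" for s t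
    using a that by (auto simp: laurent_series_def real_series_def)
  have fin: "finite {(s, t). a s t \<noteq> 0 \<and> s + t \<le> R}" for R
    using a by (simp add: laurent_series_def)
  define m where "m = Min ((\<lambda>(s, t). s + t) ` {(s, t). a s t \<noteq> 0 \<and> s + t \<le> s1 + t1})"
  have ne: "{(s, t). a s t \<noteq> 0 \<and> s + t \<le> s1 + t1} \<noteq> {}" using a1 by auto
  have "m \<in> (\<lambda>(s, t). s + t) ` {(s, t). a s t \<noteq> 0 \<and> s + t \<le> s1 + t1}"
    unfolding m_def using fin ne by (intro Min_in) auto
  then obtain s0 t0 where st0: "a s0 t0 \<noteq> 0" "m = s0 + t0" and "m \<le> s1 + t1" by auto
  have m_le: "m \<le> s + t" if "a s t \<noteq> 0" for s t
  proof (cases "s + t \<le> s1 + t1")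
    case True
    have "(\<lambda>(s, t). s + t) (s, t) \<in> (\<lambda>(s, t). s + t) ` {(s, t). a s t \<noteq> 0 \<and> s + t \<le> s1 + t1}"
      by (rule imageI) (use True that in auto)
    then show ?thesis
      unfolding m_def using fin by (intro Min_le) auto
  qed (use \<open>m \<le> s1 + t1\<close> in linarith)
  define S0 where "S0 = {(s, t). a s t \<noteq> 0 \<and> s + t = m}"
  have finS0: "finite S0" unfolding S0_def by (rule finite_subset[OF _ fin[of m]]) auto
  define G where "G = (\<lambda>(s, t). s + t - m) ` {(s, t). a s t \<noteq> 0 \<and> s + t \<le> m + 1 \<and> s + t \<noteq> m}"
  have finG: "finite G"
    unfolding G_def by (intro finite_imageI finite_subset[OF _ fin[of "m + 1"]]) auto
  define \<delta> where "\<delta> = Min (insert 1 G)"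
  have \<delta>: "\<delta> > 0"
    unfolding \<delta>_def using finG m_le by (subst Min_gr_iff) (force simp: G_def)+
  have gap: "m + \<delta> \<le> s + t" if "a s t \<noteq> 0" "s + t \<noteq> m" for s t
  proof (cases "s + t \<le> m + 1")
    case True
    then have "s + t - m \<in> insert 1 G" unfolding G_def using that by force
    then have "\<delta> \<le> s + t - m" unfolding \<delta>_def using finG by (intro Min_le) auto
    then show ?thesis by simp
  next
    case False
    have "\<delta> \<le> 1" unfolding \<delta>_def using finG by (intro Min_le) auto
    then show ?thesis using False by simp
  qed
  define \<rho>0 where "\<rho>0 = r / 2"
  have \<rho>0: "0 < \<rho>0" "\<rho>0 < r" using r by (auto simp: \<rho>0_def)
  define b where "b = (\<lambda>(s, t). norm (a s t) * \<rho>0 powr (s + t))"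
  have norm_term: "norm (a s t * zpow z s t) = norm (a s t) * norm z powr (s + t)" if "z \<noteq> 0" for s t z
    using norm_zpow[OF that] integral[of s t] by (cases "a s t = 0") (auto simp: norm_mult)
  have "(\<lambda>(s, t). a s t * zpow (of_real \<rho>0) s t) summable_on UNIV"
    using hs[of "of_real \<rho>0"] \<rho>0 by (auto simp: has_sum_imp_summable)
  then have "(\<lambda>x. norm ((\<lambda>(s, t). a s t * zpow (of_real \<rho>0) s t) x)) summable_on UNIV"
    by (simp only: summable_on_iff_abs_summable_on_complex)
  moreover have "(\<lambda>x. norm ((\<lambda>(s, t). a s t * zpow (of_real \<rho>0) s t) x)) = b"
    using \<rho>0 norm_term by (auto simp: b_def fun_eq_iff)
  ultimately have b_sum: "b summable_on UNIV" by simp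
  define C where "C = infsum b (- S0)"
  have b_sum': "b summable_on - S0" using b_sum summable_on_subset_banach by blast
  define P where "P w = (\<Sum>(s, t)\<in>S0. a s t * w powi \<lfloor>s - t\<rfloor>)" for w
  have P_le: "norm (P w) \<le> \<rho> powr \<delta> * (C / \<rho>0 powr (m + \<delta>))"
    if w: "norm w = 1" and \<rho>: "0 < \<rho>" "\<rho> \<le> \<rho>0" for w \<rho>
  proof -
    define z where "z = of_real \<rho> * w"
    have z: "norm z = \<rho>" "z \<noteq> 0" using w \<rho> by (auto simp: z_def norm_mult)
    define f where "f = (\<lambda>(s, t). a s t * zpow z s t)"
    have f: "(f has_sum 0) UNIV" unfolding f_def using hs z \<rho> \<rho>0 by auto
    have "(f has_sum (0 - sum f S0)) (- S0)"
      using has_sum_Diff[OF f has_sum_finite[OF finS0]] by (simp add: Compl_eq_Diff_UNIV)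
    moreover have "sum f S0 = of_real (\<rho> powr m) * P w"
      unfolding P_def sum_distrib_left f_def
      by (intro sum.cong refl)
         (use zpow_polar[OF \<rho>(1) w] integral in \<open>auto simp: S0_def z_def\<close>)
    ultimately have hsC: "(f has_sum (- (of_real (\<rho> powr m) * P w))) (- S0)" by simp
    have le: "norm (f x) \<le> (\<rho> / \<rho>0) powr (m + \<delta>) * b x" if "x \<in> - S0" for x
    proof -
      obtain s t where x: "x = (s, t)" by (cases x)
      show ?thesis
      proof (cases "a s t = 0")
        case False
        then have ge: "m + \<delta> \<le> s + t" using gap that x by (auto simp: S0_def)
        have "\<rho> powr (s + t) = (\<rho> / \<rho>0) powr (s + t) * \<rho>0 powr (s + t)"
          using \<rho> \<rho>0 by (simp add: powr_divide)
        also have "(\<rho> / \<rho>0) powr (s + t) \<le> (\<rho> / \<rho>0) powr (m + \<delta>)"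
          using \<rho> \<rho>0 ge by (intro powr_mono') auto
        finally have "\<rho> powr (s + t) \<le> (\<rho> / \<rho>0) powr (m + \<delta>) * \<rho>0 powr (s + t)"
          by (simp add: mult_right_mono)
        then have "norm (a s t) * \<rho> powr (s + t)
            \<le> norm (a s t) * ((\<rho> / \<rho>0) powr (m + \<delta>) * \<rho>0 powr (s + t))"
          by (rule mult_left_mono) simp
        then show ?thesis
          using norm_term[OF z(2), of s t] z by (simp add: x f_def b_def mult_ac)
      qed (simp add: x f_def b_def)
    qed
    have "norm (- (of_real (\<rho> powr m) * P w)) \<le> (\<rho> / \<rho>0) powr (m + \<delta>) * C"
    proof (rule norm_infsum_le[OF hsC])
      show "((\<lambda>x. (\<rho> / \<rho>0) powr (m + \<delta>) * b x) has_sum (\<rho> / \<rho>0) powr (m + \<delta>) * C) (- S0)"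
        unfolding C_def by (intro has_sum_cmult_right has_sum_infsum b_sum')
    qed (use le in auto)
    then have "\<rho> powr m * norm (P w) \<le> \<rho> powr m * (\<rho> powr \<delta> * (C / \<rho>0 powr (m + \<delta>)))"
      using \<rho> \<rho>0 by (simp add: norm_mult powr_divide powr_add mult_ac)
    then show ?thesis using \<rho> by (simp del: times_divide_eq_right)
  qed
  have P0: "P w = 0" if w: "norm w = 1" for w
  proof (rule ccontr)
    assume "P w \<noteq> 0"
    define x K where "x = norm (P w)" and "K = C / \<rho>0 powr (m + \<delta>)"
    have x: "x > 0" using \<open>P w \<noteq> 0\<close> by (simp add: x_def)
    have le: "x \<le> \<rho> powr \<delta> * K" if "0 < \<rho>" "\<rho> \<le> \<rho>0" for \<rho>
      using P_le[OF w that] by (simp add: x_def K_def)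
    have K: "K > 0"
      using le[of \<rho>0] \<rho>0 x by (smt (verit) mult_nonneg_nonpos powr_ge_zero)
    \<comment> \<open>This choice makes \<open>\<rho>\<^sup>\<delta> K \<le> x / 2\<close>.\<close>
    define \<rho> where "\<rho> = min \<rho>0 ((x / (2 * K)) powr (1 / \<delta>))"
    have "\<rho> > 0" using \<rho>0 x K by (simp add: \<rho>_def)
    have "\<rho> powr \<delta> \<le> ((x / (2 * K)) powr (1 / \<delta>)) powr \<delta>"
      using \<delta> \<open>\<rho> > 0\<close> by (intro powr_mono2) (auto simp: \<rho>_def)
    also have "\<dots> = x / (2 * K)" using \<delta> x K by (simp add: powr_powr)
    finally have "\<rho> powr \<delta> * K \<le> x / 2" using K by (simp add: field_simps)
    moreover have "x \<le> \<rho> powr \<delta> * K" using \<open>\<rho> > 0\<close> by (intro le) (simp_all add: \<rho>_def)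
    ultimately show False using x by linarith
  qed
  \<comment> \<open>In degree \<open>m\<close> the frequency \<open>k = s - t\<close> determines \<open>s\<close> and \<open>t\<close>.\<close>
  define c where "c k = a ((m + of_int k) / 2) ((m - of_int k) / 2)" for k :: int
  define S where "S = (\<lambda>(s, t). \<lfloor>s - t\<rfloor>) ` S0"
  have half_sum: "(m + of_int \<lfloor>s - t\<rfloor>) / 2 = s \<and> (m - of_int \<lfloor>s - t\<rfloor>) / 2 = t"
    if "(s, t) \<in> S0" for s t
    using that of_int_floor_diff[of s t] integral[of s t] by (auto simp: S0_def)
  have inj: "inj_on (\<lambda>(s, t). \<lfloor>s - t\<rfloor>) S0"
  proof (rule inj_onI, clarify)
    fix s t s' t' assume "(s, t) \<in> S0" "(s', t') \<in> S0" "\<lfloor>s - t\<rfloor> = \<lfloor>s' - t'\<rfloor>"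
    then show "s = s' \<and> t = t'" using half_sum[of s t] half_sum[of s' t'] by metis
  qed
  have c_S0: "c \<lfloor>s - t\<rfloor> = a s t" if "(s, t) \<in> S0" for s t
    unfolding c_def using half_sum[OF that] by metis
  have "(\<Sum>k\<in>S. c k * w powi k) = P w" for w
    unfolding S_def P_def sum.reindex[OF inj]
    by (rule sum.cong[OF refl]) (auto simp: c_S0)
  then have zero: "(\<Sum>k\<in>S. c k * w powi k) = 0" if "norm w = 1" for w
    using P0[OF that] by simp
  have in_S0: "(s0, t0) \<in> S0" using st0 by (simp add: S0_def)
  then have "\<lfloor>s0 - t0\<rfloor> \<in> S" unfolding S_def by force
  moreover have "finite S" unfolding S_def using finS0 by simp
  ultimately have "c \<lfloor>s0 - t0\<rfloor> = 0"
    using zero by (intro trigonometric_polynomial_zero[of S c])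
  then show False using c_S0[OF in_S0] st0 by simp
qed

lemma laurent_series_add:
  fixes a b :: "complex series"
  assumes "laurent_series a" "laurent_series b"
  shows "laurent_series (\<lambda>s t. a s t + b s t)"
proof -
  obtain N M where N: "\<forall>s t. s \<le> N \<or> t \<le> N \<longrightarrow> a s t = 0" and M: "\<forall>s t. s \<le> M \<or> t \<le> M \<longrightarrow> b s t = 0"
    using assms unfolding laurent_series_def by metis
  have "\<forall>s t. s \<le> min N M \<or> t \<le> min N M \<longrightarrow> a s t + b s t = 0"
    using N M by simp
  moreover have "finite {(s, t). a s t + b s t \<noteq> 0 \<and> s + t \<le> R}" for R
  proof (rule finite_subset)
    show "finite ({(s, t). a s t \<noteq> 0 \<and> s + t \<le> R} \<union> {(s, t). b s t \<noteq> 0 \<and> s + t \<le> R})"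
      using assms by (auto simp: laurent_series_def)
  qed auto
  moreover have "s - t \<in> \<int>" if "a s t + b s t \<noteq> 0" for s t
  proof -
    have "a s t \<noteq> 0 \<or> b s t \<noteq> 0" using that by auto
    then show ?thesis using assms by (auto simp: laurent_series_def real_series_def)
  qed
  ultimately show ?thesis
    unfolding laurent_series_def real_series_def by blast
qed

lemma laurent_series_uminus:
  fixes a :: "complex series"
  shows "laurent_series a \<Longrightarrow> laurent_series (\<lambda>s t. - a s t)"
  by (simp add: laurent_series_def real_series_def)

lemma converges_near_0_add:
  assumes "converges_near_0 a \<phi>" "converges_near_0 b \<psi>"
  shows "converges_near_0 (\<lambda>s t. a s t + b s t) (\<lambda>z. \<phi> z + \<psi> z)"
proof -
  obtain r r' where "r > 0" "r' > 0"
    and "\<forall>z. 0 < norm z \<and> norm z < r \<longrightarrow> ((\<lambda>(s, t). a s t * zpow z s t) has_sum \<phi> z) UNIV"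
    and "\<forall>z. 0 < norm z \<and> norm z < r' \<longrightarrow> ((\<lambda>(s, t). b s t * zpow z s t) has_sum \<psi> z) UNIV"
    using assms unfolding converges_near_0_def by blast
  then show ?thesis
    unfolding converges_near_0_def
    by (intro exI[of _ "min r r'"])
       (auto simp: case_prod_unfold distrib_right intro!: has_sum_add)
qed

lemma converges_near_0_uminus:
  "converges_near_0 a \<phi> \<Longrightarrow> converges_near_0 (\<lambda>s t. - a s t) (\<lambda>z. - \<phi> z)"
  unfolding converges_near_0_def case_prod_unfold by (simp add: has_sum_uminus)

lemma laurent_series_unique:
  assumes "laurent_series a" "laurent_series b" "converges_near_0 a \<phi>" "converges_near_0 b \<phi>"
  shows "a = b"
proof -
  have "a s t + - b s t = 0" for s t
    by (rule laurent_series_zero[where a = "\<lambda>s t. a s t + - b s t"])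
       (use assms laurent_series_add[OF _ laurent_series_uminus]
          converges_near_0_add[OF _ converges_near_0_uminus, of a \<phi> b \<phi>] in auto)
  then show ?thesis by (auto simp: fun_eq_iff)
qed

section \<open>Expansions at the three points\<close>

lemma is_expansion_converges:
  "is_expansion U \<phi> f a \<Longrightarrow> converges_near_0 a (\<lambda>z. f (inv_into U \<phi> z))"
  unfolding is_expansion_def converges_near_0_def by blast

lemma j_series_eq:
  assumes "is_expansion U \<phi> f a"
  shows "j_series U \<phi> f = a"
  unfolding j_series_def
proof (rule the_equality)
  show "is_expansion U \<phi> f a" by (rule assms)
  fix b assume "is_expansion U \<phi> f b"
  moreover from assms this have "laurent_series a" "laurent_series b"
    by (simp_all add: is_expansion_def)
  ultimately show "b = a"
    using assms laurent_series_unique is_expansion_converges by blast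
qed

lemma is_expansion_j_series:
  "\<exists>a. is_expansion U \<phi> f a \<Longrightarrow> is_expansion U \<phi> f (j_series U \<phi> f)"
  using j_series_eq by metis

lemma cp1_at_infinity_simps:
  "cp1_at_infinity 0 = None" "w \<noteq> 0 \<Longrightarrow> cp1_at_infinity w = Some (1 / w)"
  by (auto simp: cp1_at_infinity_def)

lemma coord_at_infinity: "coord (cp1_at_infinity w) = 1 / w"
  by (auto simp: coord_def cp1_at_infinity_def)

lemma coord_inverse_at_infinity: "coord_inverse (cp1_at_infinity w) = w"
  by (auto simp: coord_inverse_def cp1_at_infinity_def)

lemma coord_inverse_Some: "coord_inverse (Some z) = inverse z"
  by (simp add: coord_inverse_def)

lemma inj_on_coord: "inj_on coord (- {None})"
  by (rule inj_onI) (auto simp: coord_def)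

lemma inj_on_coord_inverse: "inj_on coord_inverse (- {Some 0})"
  by (rule inj_onI) (auto simp: coord_inverse_def split: option.splits)

lemma cp1_at_infinity_neq_0: "cp1_at_infinity w \<in> - {Some 0}"
  by (simp add: cp1_at_infinity_def)

lemma inv_coord: "inv_into (- {None}) coord z = Some z"
  by (rule inv_into_f_eq[OF inj_on_coord]) (auto simp: coord_def)

lemma inv_coord_inverse: "inv_into (- {Some 0}) coord_inverse w = cp1_at_infinity w"
  by (rule inv_into_f_eq[OF inj_on_coord_inverse])
     (simp_all add: cp1_at_infinity_neq_0 coord_inverse_at_infinity del: Compl_iff)

lemma inj_on_coord_1: "inj_on (\<lambda>p. 1 - coord_inverse p) (- {Some 0})"
  using inj_on_coord_inverse by (simp add: inj_on_def)

lemma inv_coord_1: "inv_into (- {Some 0}) (\<lambda>p. 1 - coord_inverse p) w = cp1_at_infinity (1 - w)"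
  by (rule inv_into_f_eq[OF inj_on_coord_1])
     (simp_all add: cp1_at_infinity_neq_0 coord_inverse_at_infinity del: Compl_iff)

lemma image_coord: "coord ` (- {None}) = UNIV"
proof -
  have "z \<in> coord ` (- {None})" for z
    by (rule image_eqI[of _ _ "Some z"]) (auto simp: coord_def)
  then show ?thesis by auto
qed

lemma image_coord_inverse: "coord_inverse ` (- {Some 0}) = UNIV"
  using cp1_at_infinity_neq_0 coord_inverse_at_infinity by (metis UNIV_eq_I image_eqI)

lemma image_coord_1: "(\<lambda>p. 1 - coord_inverse p) ` (- {Some 0}) = UNIV"
proof -
  have "z \<in> (\<lambda>p. 1 - coord_inverse p) ` (- {Some 0})" for z
    by (rule image_eqI[of _ _ "cp1_at_infinity (1 - z)"])
       (simp_all add: coord_inverse_at_infinity cp1_at_infinity_neq_0 del: Compl_iff)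
  then show ?thesis by auto
qed

lemma vimage_punctured_sphere:
  "Some -` (- {None :: cp1}) = UNIV" "cp1_at_infinity -` (- {None}) = - {0}"
  "Some -` (- {Some (0::complex)}) = - {0}" "cp1_at_infinity -` (- {Some 0}) = UNIV"
  by (auto simp: cp1_at_infinity_def split: if_splits)

lemma chart_coord: "chart_at (Some 0) (- {None}) coord"
proof -
  have "(\<lambda>w. coord (cp1_at_infinity w)) holomorphic_on - {0}"
    unfolding coord_at_infinity by (auto intro!: holomorphic_intros)
  then show ?thesis
    unfolding chart_at_def cp1_open_def cp1_holomorphic_on_def vimage_punctured_sphere
    using inj_on_coord by (auto simp: coord_def intro!: holomorphic_intros)
qed

lemma chart_coord_inverse: "chart_at None (- {Some 0}) coord_inverse"
  unfolding chart_at_def cp1_open_def cp1_holomorphic_on_def vimage_punctured_sphere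
    coord_inverse_at_infinity coord_inverse_Some
  using inj_on_coord_inverse by (auto simp: coord_inverse_def intro!: holomorphic_intros)

lemma chart_coord_1: "chart_at (Some 1) (- {Some 0}) (\<lambda>p. 1 - coord_inverse p)"
  unfolding chart_at_def cp1_open_def cp1_holomorphic_on_def vimage_punctured_sphere
    coord_inverse_at_infinity coord_inverse_Some
  using inj_on_coord_1 by (auto simp: coord_inverse_def intro!: holomorphic_intros)

text \<open>
  The part of the definition of \<^const>\<open>F_01inf\<close> that concerns the three standard charts. Unlike
  membership in \<^const>\<open>F_01inf\<close>, it is immediate for the zero function, since these charts are onto
  the complex plane.
\<close>

definition three_point_function :: "(cp1 \<Rightarrow> complex) \<Rightarrow> bool" where
  "three_point_function f \<longleftrightarrow>
     real_analytic_on (- {0, 1}) (f \<circ> Some) \<and>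
     is_expansion (- {None}) coord f (j_0 f) \<and>
     is_expansion (- {Some 0}) coord_inverse f (j_inf f) \<and>
     is_expansion (- {Some 0}) (\<lambda>p. 1 - coord_inverse p) f (j_1 f)"

lemma three_point_function_F_01inf:
  assumes "f \<in> F_01inf"
  shows "three_point_function f"
proof -
  have ra: "real_analytic_on (- {0, 1}) (f \<circ> Some)"
    and e: "\<And>\<alpha> U \<phi>. \<alpha> \<in> {Some 0, Some 1, None} \<Longrightarrow> chart_at \<alpha> U \<phi> \<Longrightarrow> \<exists>a. is_expansion U \<phi> f a"
    using assms unfolding F_01inf_def by blast+
  show ?thesis
    unfolding three_point_function_def j_0_def j_inf_def j_1_def
    by (intro conjI ra is_expansion_j_series e[OF _ chart_coord] e[OF _ chart_coord_inverse]
        e[OF _ chart_coord_1]) simp_all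
qed

lemma converges_j_0: "three_point_function f \<Longrightarrow> converges_near_0 (j_0 f) (\<lambda>z. f (Some z))"
  by (auto simp: three_point_function_def inv_coord dest: is_expansion_converges)

lemma converges_j_inf: "three_point_function f \<Longrightarrow> converges_near_0 (j_inf f) (\<lambda>w. f (cp1_at_infinity w))"
  by (auto simp: three_point_function_def inv_coord_inverse dest: is_expansion_converges)

lemma converges_j_1:
  "three_point_function f \<Longrightarrow> converges_near_0 (j_1 f) (\<lambda>w. f (cp1_at_infinity (1 - w)))"
  by (auto simp: three_point_function_def inv_coord_1 dest: is_expansion_converges)

lemma laurent_j:
  assumes "three_point_function f"
  shows "laurent_series (j_0 f)" "laurent_series (j_inf f)" "laurent_series (j_1 f)"
  using assms by (auto simp: three_point_function_def is_expansion_def)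

lemma real_analytic_on_add:
  assumes "real_analytic_on S f" "real_analytic_on S g"
  shows "real_analytic_on S (\<lambda>z. f z + g z)"
  unfolding real_analytic_on_def
proof
  fix p assume "p \<in> S"
  then obtain c r where "r > 0"
    and c: "\<And>z. z \<in> ball p r \<Longrightarrow>
        ((\<lambda>(m, n). c m n * of_real (Re (z - p)) ^ m * of_real (Im (z - p)) ^ n) has_sum f z) UNIV"
    using assms(1) unfolding real_analytic_on_def by blast
  obtain d r' where "r' > 0"
    and d: "\<And>z. z \<in> ball p r' \<Longrightarrow>
        ((\<lambda>(m, n). d m n * of_real (Re (z - p)) ^ m * of_real (Im (z - p)) ^ n) has_sum g z) UNIV"
    using assms(2) \<open>p \<in> S\<close> unfolding real_analytic_on_def by blast
  have "((\<lambda>(m, n). (c m n + d m n) * of_real (Re (z - p)) ^ m * of_real (Im (z - p)) ^ n)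
      has_sum f z + g z) UNIV" if "z \<in> ball p (min r r')" for z
    using has_sum_add[OF c d, of z] that by (simp add: case_prod_unfold algebra_simps)
  then show "\<exists>c r. r > 0 \<and> (\<forall>z\<in>ball p r.
      ((\<lambda>(m, n). c m n * of_real (Re (z - p)) ^ m * of_real (Im (z - p)) ^ n) has_sum f z + g z) UNIV)"
    using \<open>r > 0\<close> \<open>r' > 0\<close>
    by (intro exI[of _ "\<lambda>m n. c m n + d m n"] exI[of _ "min r r'"]) simp
qed

lemma real_analytic_on_cnj:
  assumes "real_analytic_on S f"
  shows "real_analytic_on S (\<lambda>z. cnj (f z))"
  unfolding real_analytic_on_def
proof
  fix p assume "p \<in> S"
  with assms obtain c r where "r > 0"
    and c: "\<And>z. z \<in> ball p r \<Longrightarrow>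
        ((\<lambda>(m, n). c m n * of_real (Re (z - p)) ^ m * of_real (Im (z - p)) ^ n) has_sum f z) UNIV"
    unfolding real_analytic_on_def by blast
  have "((\<lambda>(m, n). cnj (c m n) * of_real (Re (z - p)) ^ m * of_real (Im (z - p)) ^ n)
      has_sum cnj (f z)) UNIV" if "z \<in> ball p r" for z
    using c[OF that] has_sum_cnj_iff[of "\<lambda>(m, n). c m n * of_real (Re (z - p)) ^ m * of_real (Im (z - p)) ^ n"]
    by (simp add: case_prod_unfold)
  then show "\<exists>c r. r > 0 \<and> (\<forall>z\<in>ball p r.
      ((\<lambda>(m, n). c m n * of_real (Re (z - p)) ^ m * of_real (Im (z - p)) ^ n) has_sum cnj (f z)) UNIV)"
    using \<open>r > 0\<close> by (intro exI[of _ "\<lambda>m n. cnj (c m n)"] exI[of _ r]) simp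
qed

text \<open>
  Absolute convergence of two series may be witnessed by different shifts and radii; a larger shift
  and a smaller radius serve for both.
\<close>

lemma abs_conv_weaken:
  assumes summ: "(\<lambda>(s, t). norm (a s t) * R powr ((s + N) + (t + N))) summable_on UNIV"
    and supp: "\<And>s t. a s t \<noteq> 0 \<Longrightarrow> s + N \<ge> 0 \<and> t + N \<ge> 0"
    and "N \<le> M" "0 < R'" "R' \<le> R"
  shows "(\<lambda>(s, t). norm (a s t) * R' powr ((s + M) + (t + M))) summable_on UNIV"
proof (rule summable_on_comparison_test)
  show "(\<lambda>x. R' powr (2 * (M - N)) * (\<lambda>(s, t). norm (a s t) * R powr ((s + N) + (t + N))) x) summable_on UNIV"
    by (intro summable_on_cmult_right summ)
  fix x :: "real \<times> real"
  obtain s t where x: "x = (s, t)" by (cases x)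
  show "(\<lambda>(s, t). norm (a s t) * R' powr ((s + M) + (t + M))) x
      \<le> R' powr (2 * (M - N)) * (\<lambda>(s, t). norm (a s t) * R powr ((s + N) + (t + N))) x"
  proof (cases "a s t = 0")
    case False
    have "R' powr ((s + M) + (t + M)) = R' powr (2 * (M - N)) * R' powr ((s + N) + (t + N))"
      by (simp add: powr_add[symmetric] algebra_simps)
    also have "\<dots> \<le> R' powr (2 * (M - N)) * R powr ((s + N) + (t + N))"
      using supp[OF False] assms by (intro mult_left_mono powr_mono2) auto
    finally have "norm (a s t) * R' powr ((s + M) + (t + M))
        \<le> norm (a s t) * (R' powr (2 * (M - N)) * R powr ((s + N) + (t + N)))"
      by (rule mult_left_mono) simp
    then show ?thesis by (simp add: x mult_ac)
  qed (simp add: x)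
qed auto

lemma abs_conv_at_0_add:
  assumes "abs_conv_at_0 a" "abs_conv_at_0 b"
  shows "abs_conv_at_0 (\<lambda>s t. a s t + b s t)"
proof -
  obtain N R where R: "R > 0"
    and a: "\<And>s t. a s t \<noteq> 0 \<Longrightarrow> s + N \<ge> 0 \<and> t + N \<ge> 0"
      "(\<lambda>(s, t). norm (a s t) * R powr ((s + N) + (t + N))) summable_on UNIV"
    using assms(1) unfolding abs_conv_at_0_def by blast
  obtain N' R' where R': "R' > 0"
    and b: "\<And>s t. b s t \<noteq> 0 \<Longrightarrow> s + N' \<ge> 0 \<and> t + N' \<ge> 0"
      "(\<lambda>(s, t). norm (b s t) * R' powr ((s + N') + (t + N'))) summable_on UNIV"
    using assms(2) unfolding abs_conv_at_0_def by blast
  define M Q where "M = max N N'" and "Q = min R R'"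
  define A B where "A = (\<lambda>(s, t). norm (a s t) * Q powr ((s + M) + (t + M)))"
    and "B = (\<lambda>(s, t). norm (b s t) * Q powr ((s + M) + (t + M)))"
  have A: "A summable_on UNIV"
    unfolding A_def by (rule abs_conv_weaken[OF a(2,1)]) (use R R' in \<open>auto simp: M_def Q_def\<close>)
  have B: "B summable_on UNIV"
    unfolding B_def by (rule abs_conv_weaken[OF b(2,1)]) (use R R' in \<open>auto simp: M_def Q_def\<close>)
  have "(\<lambda>(s, t). norm (a s t + b s t) * Q powr ((s + M) + (t + M))) summable_on UNIV"
  proof (rule summable_on_comparison_test[OF summable_on_add[OF A B]])
    fix x :: "real \<times> real"
    show "(\<lambda>(s, t). norm (a s t + b s t) * Q powr ((s + M) + (t + M))) x \<le> A x + B x"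
      by (cases x)
         (auto simp: A_def B_def distrib_right[symmetric] intro!: mult_right_mono norm_triangle_ineq)
  qed auto
  moreover have "s + M \<ge> 0 \<and> t + M \<ge> 0" if "a s t + b s t \<noteq> 0" for s t
  proof (cases "a s t = 0")
    case True
    then show ?thesis using that b(1)[of s t] by (auto simp: M_def)
  next
    case False
    then show ?thesis using a(1)[of s t] by (auto simp: M_def)
  qed
  moreover have "Q > 0" using R R' by (simp add: Q_def)
  ultimately show ?thesis unfolding abs_conv_at_0_def by blast
qed

lemma is_expansion_add:
  assumes "is_expansion U \<phi> f a" "is_expansion U \<phi> g b"
  shows "is_expansion U \<phi> (\<lambda>p. f p + g p) (\<lambda>s t. a s t + b s t)"
proof -
  obtain r where r: "r > 0" "ball 0 r \<subseteq> \<phi> ` U"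
    using assms(1) by (auto simp: is_expansion_def)
  obtain r' where r': "r' > 0" "\<forall>z. 0 < norm z \<and> norm z < r' \<longrightarrow>
      ((\<lambda>(s, t). (a s t + b s t) * zpow z s t) has_sum f (inv_into U \<phi> z) + g (inv_into U \<phi> z)) UNIV"
    using converges_near_0_add[OF assms[THEN is_expansion_converges]]
    unfolding converges_near_0_def by blast
  show ?thesis
    unfolding is_expansion_def
  proof (intro conjI exI[of _ "min r r'"])
    show "laurent_series (\<lambda>s t. a s t + b s t)" "abs_conv_at_0 (\<lambda>s t. a s t + b s t)"
      using assms by (auto simp: is_expansion_def intro: laurent_series_add abs_conv_at_0_add)
  qed (use r r' in auto)
qed

lemma three_point_function_add:
  assumes "three_point_function f" "three_point_function g"
  shows "three_point_function (\<lambda>p. f p + g p)"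
    and "j_0 (\<lambda>p. f p + g p) = (\<lambda>s t. j_0 f s t + j_0 g s t)"
    and "j_inf (\<lambda>p. f p + g p) = (\<lambda>s t. j_inf f s t + j_inf g s t)"
    and "j_1 (\<lambda>p. f p + g p) = (\<lambda>s t. j_1 f s t + j_1 g s t)"
proof -
  have "is_expansion (- {None}) coord (\<lambda>p. f p + g p) (\<lambda>s t. j_0 f s t + j_0 g s t)"
    "is_expansion (- {Some 0}) coord_inverse (\<lambda>p. f p + g p) (\<lambda>s t. j_inf f s t + j_inf g s t)"
    "is_expansion (- {Some 0}) (\<lambda>p. 1 - coord_inverse p) (\<lambda>p. f p + g p) (\<lambda>s t. j_1 f s t + j_1 g s t)"
    using assms by (auto simp: three_point_function_def intro!: is_expansion_add)
  moreover from this
  show j: "j_0 (\<lambda>p. f p + g p) = (\<lambda>s t. j_0 f s t + j_0 g s t)"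
    "j_inf (\<lambda>p. f p + g p) = (\<lambda>s t. j_inf f s t + j_inf g s t)"
    "j_1 (\<lambda>p. f p + g p) = (\<lambda>s t. j_1 f s t + j_1 g s t)"
    unfolding j_0_def j_inf_def j_1_def by (simp_all only: j_series_eq)
  moreover have "real_analytic_on (- {0, 1}) ((\<lambda>p. f p + g p) \<circ> Some)"
    using assms[unfolded three_point_function_def, THEN conjunct1]
      real_analytic_on_add[of "- {0, 1}" "f \<circ> Some" "g \<circ> Some"]
    by (simp only: o_def)
  ultimately show "three_point_function (\<lambda>p. f p + g p)"
    unfolding three_point_function_def j by blast
qed

lemma laurent_series_0: "laurent_series (\<lambda>s t. 0)"
  by (simp add: laurent_series_def real_series_def)

lemma three_point_function_0:
  shows "three_point_function (\<lambda>_. 0)"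
    and "j_0 (\<lambda>_. 0) = (\<lambda>s t. 0)" "j_inf (\<lambda>_. 0) = (\<lambda>s t. 0)" "j_1 (\<lambda>_. 0) = (\<lambda>s t. 0)"
proof -
  have "abs_conv_at_0 (\<lambda>s t. 0)"
  proof -
    have "(\<lambda>(s, t). norm (0::complex) * 1 powr ((s + 0) + (t + 0))) summable_on UNIV"
      by (simp add: case_prod_unfold)
    then show ?thesis unfolding abs_conv_at_0_def using zero_less_one by blast
  qed
  then have e: "is_expansion U \<phi> (\<lambda>_. 0) (\<lambda>s t. 0)" if "\<phi> ` U = UNIV" for U \<phi>
  proof -
    have "((\<lambda>(s, t). 0 * zpow z s t) has_sum 0) UNIV" for z
      by (simp add: case_prod_unfold)
    then show ?thesis
      unfolding is_expansion_def using laurent_series_0 that \<open>abs_conv_at_0 (\<lambda>s t. 0)\<close> zero_less_one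
      by blast
  qed
  note es = e[OF image_coord] e[OF image_coord_inverse] e[OF image_coord_1]
  then show j: "j_0 (\<lambda>_. 0) = (\<lambda>s t. 0)" "j_inf (\<lambda>_. 0) = (\<lambda>s t. 0)" "j_1 (\<lambda>_. 0) = (\<lambda>s t. 0)"
    unfolding j_0_def j_inf_def j_1_def by (simp_all only: j_series_eq)
  have "real_analytic_on (- {0, 1}) ((\<lambda>_. 0) \<circ> Some)"
    unfolding real_analytic_on_def
  proof
    fix p :: complex
    have h: "((\<lambda>(m, n). 0 * of_real (Re (z - p)) ^ m * of_real (Im (z - p)) ^ n) has_sum
        ((\<lambda>_. 0) \<circ> Some) z) UNIV" for z :: complex
      by (simp add: case_prod_unfold)
    show "\<exists>c r. r > 0 \<and> (\<forall>z\<in>ball p r. ((\<lambda>(m, n). c m n * of_real (Re (z - p)) ^ m *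
        of_real (Im (z - p)) ^ n) has_sum ((\<lambda>_. 0 :: complex) \<circ> Some) z) UNIV)"
      by (intro exI[of _ "\<lambda>_ _. 0"] exI[of _ "1::real"] conjI ballI zero_less_one h)
  qed
  then show "three_point_function (\<lambda>_. 0)"
    unfolding three_point_function_def j using es by blast
qed

section \<open>Functions with a monomial expansion at 0\<close>

lemma zpow_antiholomorphic:
  assumes "z \<noteq> 0"
  shows "zpow z 0 (of_int b) = cnj z powi b"
proof -
  have "norm z powr (2 * of_int b) = (norm z ^ 2) powi b"
    using assms powr_real_of_int'[of "norm z" "2 * b"] by (simp add: power_int_mult power2_eq_square power_int_def[symmetric])
  also have "of_real \<dots> = (z * cnj z) powi b"
    by (simp only: complex_norm_square[symmetric] of_real_power_int of_real_power)
  finally show ?thesis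
    using assms by (simp add: zpow_def power_int_mult_distrib power_int_minus field_simps)
qed

lemma monomial_has_sum:
  "((\<lambda>(s, t). (if s = s0 \<and> t = t0 then C else 0) * zpow z s t) has_sum C * zpow z s0 t0) UNIV"
  by (rule has_sum_finite_neutralI[of "{(s0, t0)}"]) (auto split: if_splits)

lemma laurent_series_monomial:
  fixes C :: complex
  assumes "s0 - t0 \<in> \<int>"
  shows "laurent_series (\<lambda>s t. if s = s0 \<and> t = t0 then C else 0)"
  unfolding laurent_series_def
proof (intro conjI allI exI[of _ "min s0 t0 - 1"])
  show "real_series (\<lambda>s t. if s = s0 \<and> t = t0 then C else 0)"
    using assms by (auto simp: real_series_def)
  show "finite {(s, t). (if s = s0 \<and> t = t0 then C else 0) \<noteq> 0 \<and> s + t \<le> R}" for R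
    by (rule finite_subset[of _ "{(s0, t0)}"]) (auto split: if_splits)
qed (auto split: if_splits)

text \<open>
  Near \<open>0\<close> the expansion gives the formula, and the complex conjugate of \<open>f\<close> agrees there with the
  holomorphic function \<open>cnj C * z\<^sup>b\<close>. Both sides are defined and analytic on the connected set of all
  \<open>z \<noteq> 0, 1\<close>.
\<close>

lemma three_point_function_antiholomorphic:
  assumes f: "three_point_function f"
    and j: "j_0 f = (\<lambda>s t. if s = 0 \<and> t = of_int b then C else 0)"
    and z: "z \<noteq> 0" "z \<noteq> 1"
  shows "f (Some z) = C * cnj z powi b"
proof -
  obtain r where r: "r > 0" and hs: "\<And>z. 0 < norm z \<Longrightarrow> norm z < r \<Longrightarrow>
      ((\<lambda>(s, t). j_0 f s t * zpow z s t) has_sum f (Some z)) UNIV"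
    using converges_j_0[OF f] unfolding converges_near_0_def by blast
  have near: "f (Some z) = C * cnj z powi b" if "0 < norm z" "norm z < r" for z
  proof -
    have "f (Some z) = C * zpow z 0 (of_int b)"
      using hs[OF that, unfolded j] monomial_has_sum by (rule has_sum_unique)
    then show ?thesis using that by (simp add: zpow_antiholomorphic)
  qed
  \<comment> \<open>The disc of radius \<open>\<rho>/2\<close> about \<open>\<rho>\<close> lies in the punctured disc where the formula holds.\<close>
  define \<rho> where "\<rho> = min r 1 / 2"
  have \<rho>: "0 < \<rho>" "\<rho> < 1" "3 / 2 * \<rho> < r" using r by (auto simp: \<rho>_def min_def)
  note identity = real_analytic_eq_holomorphic[of "- {0, 1}" "\<lambda>z. cnj (f (Some z))"
      "\<lambda>z. cnj C * z powi b" "of_real \<rho>" "\<rho> / 2" z]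
  have "cnj (f (Some z)) = cnj C * z powi b"
  proof (rule identity)
    show "connected (- {0, 1 :: complex})"
      using connected_open_diff_countable[of "UNIV :: complex set" "{0, 1}"]
      by (simp add: Compl_eq_Diff_UNIV connected_UNIV)
    show "open (- {0, 1 :: complex})" by (simp add: open_Compl finite_imp_closed)
    show "real_analytic_on (- {0, 1}) (\<lambda>z. cnj (f (Some z)))"
      using f real_analytic_on_cnj[of "- {0, 1}" "f \<circ> Some"]
      by (simp add: three_point_function_def)
    show "(\<lambda>z. cnj C * z powi b) holomorphic_on - {0, 1}"
      by (auto intro!: holomorphic_intros)
    fix w :: complex assume "w \<in> ball (of_real \<rho>) (\<rho> / 2)"
    then have d: "norm (w - of_real \<rho>) < \<rho> / 2" by (simp add: dist_norm norm_minus_commute)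
    have "norm w \<le> norm (w - of_real \<rho>) + \<rho>" "\<rho> \<le> norm (w - of_real \<rho>) + norm w"
      using norm_triangle_ineq[of "w - of_real \<rho>" "of_real \<rho>"]
        norm_triangle_ineq[of "of_real \<rho> - w" w] \<rho>(1) by (simp_all add: norm_minus_commute)
    then have "0 < norm w" "norm w < r" using d \<rho> by linarith+
    from near[OF this] show "cnj (f (Some w)) = cnj C * w powi b" by simp
  qed (use \<rho> z in auto)
  then have "cnj (cnj (f (Some z))) = cnj (cnj C * z powi b)" by simp
  then show ?thesis by simp
qed

lemma converges_near_0I:
  assumes "\<And>z. z \<noteq> 0 \<Longrightarrow> norm z < 1 \<Longrightarrow> ((\<lambda>(s, t). a s t * zpow z s t) has_sum \<phi> z) UNIV"
  shows "converges_near_0 a \<phi>"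
  unfolding converges_near_0_def using assms zero_less_one by (metis zero_less_norm_iff)

lemma j_inf_antiholomorphic:
  assumes f: "three_point_function f"
    and j: "j_0 f = (\<lambda>s t. if s = 0 \<and> t = of_int b then C else 0)"
  shows "j_inf f = (\<lambda>s t. if s = 0 \<and> t = - of_int b then C else 0)"
proof (rule laurent_series_unique[OF laurent_j(2)[OF f] _ converges_j_inf[OF f]])
  show "laurent_series (\<lambda>s t. if s = 0 \<and> t = - real_of_int b then C else 0)"
    by (rule laurent_series_monomial) simp
  show "converges_near_0 (\<lambda>s t. if s = 0 \<and> t = - of_int b then C else 0)
      (\<lambda>w. f (cp1_at_infinity w))"
  proof (rule converges_near_0I)
    fix w :: complex assume w: "w \<noteq> 0" "norm w < 1"
    then have "1 / w \<noteq> 1" by auto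
    then have "f (cp1_at_infinity w) = C * cnj (1 / w) powi b"
      using w by (simp add: cp1_at_infinity_simps three_point_function_antiholomorphic[OF f j])
    also have "cnj (1 / w) powi b = zpow w 0 (of_int (- b))"
      unfolding zpow_antiholomorphic[OF w(1)]
      by (simp add: power_int_minus power_int_divide_distrib inverse_eq_divide)
    finally show "((\<lambda>(s, t). (if s = 0 \<and> t = - of_int b then C else 0) * zpow w s t)
        has_sum f (cp1_at_infinity w)) UNIV"
      using monomial_has_sum[of 0 "- of_int b" C w] by simp
  qed
qed

text \<open>
  The coordinate \<open>w = 1 - 1/z\<close> at \<open>1\<close> turns \<open>\<zbar>\<^sup>b\<close> into the conjugate of \<open>(1 - w)\<^bsup>- b\<^esup>\<close>.
\<close>

lemma at_1_near_0:
  assumes f: "three_point_function f"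
    and j: "j_0 f = (\<lambda>s t. if s = 0 \<and> t = of_int b then C else 0)"
    and w: "w \<noteq> 0" "norm w < 1"
  shows "f (cp1_at_infinity (1 - w)) = C * cnj ((1 - w) powi (- b))"
proof -
  have "1 - w \<noteq> 0" "1 / (1 - w) \<noteq> 1" using w by auto
  then show ?thesis
    by (simp add: cp1_at_infinity_simps three_point_function_antiholomorphic[OF f j]
        power_int_minus power_int_divide_distrib field_simps)
qed

lemma j_1_constant:
  assumes f: "three_point_function f"
    and j: "j_0 f = (\<lambda>s t. if s = 0 \<and> t = 0 then C else 0)"
  shows "j_1 f = (\<lambda>s t. if s = 0 \<and> t = 0 then C else 0)"
proof (rule laurent_series_unique[OF laurent_j(3)[OF f] _ converges_j_1[OF f]])
  show "laurent_series (\<lambda>s t. if s = 0 \<and> t = 0 then C else 0)"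
    by (rule laurent_series_monomial) simp
  have j': "j_0 f = (\<lambda>s t. if s = 0 \<and> t = of_int 0 then C else 0)" using j by simp
  show "converges_near_0 (\<lambda>s t. if s = 0 \<and> t = 0 then C else 0) (\<lambda>w. f (cp1_at_infinity (1 - w)))"
  proof (rule converges_near_0I)
    fix w :: complex assume w: "w \<noteq> 0" "norm w < 1"
    have "C * zpow w 0 0 = f (cp1_at_infinity (1 - w))"
      using at_1_near_0[OF f j' w] zpow_antiholomorphic[OF w(1), of 0] by simp
    then show "((\<lambda>(s, t). (if s = 0 \<and> t = 0 then C else 0) * zpow w s t)
        has_sum f (cp1_at_infinity (1 - w))) UNIV"
      using monomial_has_sum[of 0 0 C w] by (simp only:)
  qed
qed

text \<open>
  The function is regular at \<open>1\<close> with value \<open>C\<close>: its expansion is \<open>C\<close> times the conjugate of the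
  Taylor series of the binomial function \<open>(1 - w)\<^bsup>- b\<^esup>\<close>.
\<close>

lemma j_1_antiholomorphic:
  assumes f: "three_point_function f"
    and j: "j_0 f = (\<lambda>s t. if s = 0 \<and> t = of_int b then C else 0)"
  shows "j_1 f 0 0 = C" and "s \<noteq> 0 \<or> t \<notin> \<nat> \<Longrightarrow> j_1 f s t = 0"
proof -
  \<comment> \<open>The Taylor coefficients of \<open>(1 - w)\<^bsup>- b\<^esup>\<close>.\<close>
  define g where "g n = (deriv ^^ n) (\<lambda>w :: complex. (1 - w) powi (- b)) 0 / fact n" for n
  define a where "a s t = (if s = 0 \<and> t \<in> \<nat> then C * cnj (g (nat \<lfloor>t\<rfloor>)) else 0)" for s t :: real
  have hol: "(\<lambda>w. (1 - w) powi (- b)) holomorphic_on ball (0 :: complex) 1"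
    by (auto intro!: holomorphic_intros)
  have sums: "(\<lambda>n. g n * w ^ n) sums ((1 - w) powi (- b))" if "norm w < 1" for w
    using holomorphic_power_series[OF hol, of w] that by (simp add: g_def)
  have g_sum: "((\<lambda>n. g n * w ^ n) has_sum ((1 - w) powi (- b))) UNIV" if "norm w < 1" for w
  proof -
    define \<rho> where "\<rho> = (norm w + 1) / 2"
    have \<rho>: "norm w < \<rho>" "\<rho> < 1" "0 \<le> \<rho>" using that by (auto simp: \<rho>_def)
    then have "norm (of_real \<rho> :: complex) < 1"
      by simp
    then have "summable (\<lambda>n. g n * (of_real \<rho>) ^ n)"
      using sums sums_summable by blast
    then have "summable (\<lambda>n. norm (g n * w ^ n))"
      by (rule powser_insidea) (use \<rho> in simp)
    then show ?thesis using sums[OF that] by (rule norm_summable_imp_has_sum)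
  qed
  have "j_1 f = a"
  proof (rule laurent_series_unique[OF laurent_j(3)[OF f] _ converges_j_1[OF f]])
    show "laurent_series a"
      unfolding laurent_series_def
    proof (intro conjI allI exI[of _ "-1"])
      show "real_series a"
        by (auto simp: real_series_def a_def Nats_altdef1 split: if_splits)
      show "s \<le> - 1 \<or> t \<le> - 1 \<longrightarrow> a s t = 0" for s t
        by (auto simp: a_def elim!: Nats_cases)
      show "finite {(s, t). a s t \<noteq> 0 \<and> s + t \<le> R}" for R
      proof (rule finite_subset)
        show "{(s, t). a s t \<noteq> 0 \<and> s + t \<le> R} \<subseteq> (\<lambda>n. (0, real n)) ` {..nat \<lfloor>R\<rfloor>}"
          by (auto simp: a_def le_nat_floor elim!: Nats_cases split: if_splits)
      qed simp
    qed
    show "converges_near_0 a (\<lambda>w. f (cp1_at_infinity (1 - w)))"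
    proof (rule converges_near_0I)
      fix w :: complex assume w: "w \<noteq> 0" "norm w < 1"
      define T where "T = (\<lambda>(s, t). a s t * zpow w s t)"
      define \<iota> where "\<iota> n = (0 :: real, real n)" for n
      have inj_\<iota>: "inj \<iota>" by (simp add: \<iota>_def inj_on_def)
      have "((\<lambda>n. C * cnj (g n * w ^ n)) has_sum C * cnj ((1 - w) powi (- b))) UNIV"
        using g_sum[OF w(2)] by (intro has_sum_cmult_right) (simp only: has_sum_cnj_iff)
      also have "(\<lambda>n. C * cnj (g n * w ^ n)) = T \<circ> \<iota>"
      proof
        fix n
        have "zpow w 0 (real n) = cnj (w ^ n)"
          using zpow_antiholomorphic[OF w(1), of "int n"] by simp
        then show "C * cnj (g n * w ^ n) = (T \<circ> \<iota>) n"
          by (simp add: T_def \<iota>_def a_def)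
      qed
      finally have "(T has_sum C * cnj ((1 - w) powi (- b))) (range \<iota>)"
        using has_sum_reindex[of \<iota> UNIV T] inj_\<iota> by blast
      moreover have "T x = 0" if "x \<notin> range \<iota>" for x
        using that by (auto simp: T_def \<iota>_def a_def elim!: Nats_cases split: prod.splits)
      ultimately have "(T has_sum C * cnj ((1 - w) powi (- b))) UNIV"
        using has_sum_cong_neutral[of UNIV "range \<iota>" T T] by blast
      then show "((\<lambda>(s, t). a s t * zpow w s t) has_sum f (cp1_at_infinity (1 - w))) UNIV"
        unfolding T_def by (simp only: at_1_near_0[OF f j w])
    qed
  qed
  then show "j_1 f 0 0 = C" "s \<noteq> 0 \<or> t \<notin> \<nat> \<Longrightarrow> j_1 f s t = 0"
    by (auto simp: a_def g_def)
qed

section \<open>Components of a two-point correlation function\<close>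

text \<open>
  The coefficients of \<open>(1 + z)\<^sup>\<alpha> (1 + \<zbar>)\<^sup>\<beta> a(- z)\<close>, the formal series that occurs in the expansion for
  \<open>|z\<^sub>2| > |z\<^sub>1 - z\<^sub>2|\<close>.
\<close>

definition binomial_twist :: "real \<Rightarrow> real \<Rightarrow> complex series \<Rightarrow> complex series" where
  "binomial_twist \<alpha> \<beta> a p p' =
     (\<Sum>(i, k) | a (p - real i) (p' - real k) \<noteq> 0.
        of_real (\<alpha> gchoose i) * of_real (\<beta> gchoose k) *
        (-1) powi \<lfloor>(p - real i) - (p' - real k)\<rfloor> * a (p - real i) (p' - real k))"

lemma finite_binomial_support:
  assumes "laurent_series (a :: complex series)"
  shows "finite {(i, k). a (p - real i) (p' - real k) \<noteq> 0}"
proof -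
  obtain N where N: "\<And>s t. s \<le> N \<or> t \<le> N \<Longrightarrow> a s t = 0"
    using assms unfolding laurent_series_def by blast
  have "i < nat \<lceil>p - N\<rceil> \<and> k < nat \<lceil>p' - N\<rceil>" if "a (p - real i) (p' - real k) \<noteq> 0" for i k
  proof -
    have "p - real i > N" "p' - real k > N" using N that by (meson not_le)+
    then show ?thesis by linarith
  qed
  then have "{(i, k). a (p - real i) (p' - real k) \<noteq> 0} \<subseteq> {..<nat \<lceil>p - N\<rceil>} \<times> {..<nat \<lceil>p' - N\<rceil>}"
    by auto
  then show ?thesis by (rule finite_subset) simp
qed

lemma binomial_twist_eq:
  assumes "finite S" "{(i, k). a (p - real i) (p' - real k) \<noteq> 0} \<subseteq> S"
  shows "binomial_twist \<alpha> \<beta> a p p' = (\<Sum>(i, k)\<in>S. of_real (\<alpha> gchoose i) * of_real (\<beta> gchoose k) *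
      (-1) powi \<lfloor>(p - real i) - (p' - real k)\<rfloor> * a (p - real i) (p' - real k))"
  unfolding binomial_twist_def
proof (rule sum.mono_neutral_left[OF assms])
  show "\<forall>x\<in>S - {(i, k). a (p - real i) (p' - real k) \<noteq> 0}.
      (\<lambda>(i, k). of_real (\<alpha> gchoose i) * of_real (\<beta> gchoose k) *
      (-1) powi \<lfloor>(p - real i) - (p' - real k)\<rfloor> * a (p - real i) (p' - real k)) x = 0"
    by auto
qed

lemma binomial_twist_add:
  assumes "laurent_series a" "laurent_series b"
  shows "binomial_twist \<alpha> \<beta> (\<lambda>s t. a s t + b s t) p p' =
    binomial_twist \<alpha> \<beta> a p p' + binomial_twist \<alpha> \<beta> b p p'"
proof -
  define S where "S = {(i, k). a (p - real i) (p' - real k) \<noteq> 0} \<union>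
    {(i, k). b (p - real i) (p' - real k) \<noteq> 0}"
  have S: "finite S" unfolding S_def using assms finite_binomial_support by blast
  show ?thesis
    by (subst (1 2 3) binomial_twist_eq[OF S])
       (auto simp: S_def case_prod_unfold sum.distrib[symmetric] algebra_simps)
qed

lemma binomial_twist_0: "binomial_twist \<alpha> \<beta> (\<lambda>s t. 0) p p' = 0"
  by (simp add: binomial_twist_def)

text \<open>
  In all three expansions the total exponents of a term are \<open>(\<alpha>, \<beta>)\<close>. The summands of a presentation
  with equal total exponents can therefore be merged into one function, and coefficients with
  given totals see only this function.
\<close>

lemma presentation_component:
  assumes "\<And>\<alpha>' \<beta>' f. (\<alpha>', \<beta>', f) \<in> set ts \<Longrightarrow> three_point_function f"
  shows "\<exists>f. three_point_function f \<and>
    (\<forall>p p' q q'. p + q = \<alpha> \<longrightarrow> p' + q' = \<beta> \<longrightarrow>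
       expand_1_2 ts p p' q q' = j_0 f q q' \<and>
       expand_2_0 ts p p' q q' = binomial_twist \<alpha> \<beta> (j_1 f) p p' \<and>
       expand_2_1 ts p p' q q' = j_inf f (- q) (- q'))"
  using assms
proof (induction ts)
  case Nil
  show ?case
    by (rule exI[of _ "\<lambda>_. 0"])
       (simp add: three_point_function_0 binomial_twist_0 expand_1_2_def expand_2_0_def expand_2_1_def)
next
  case (Cons x ts)
  obtain \<alpha>' \<beta>' g where x: "x = (\<alpha>', \<beta>', g)" by (cases x)
  have g: "three_point_function g" using Cons.prems x by auto
  obtain f where f: "three_point_function f"
    and ts: "\<And>p p' q q'. p + q = \<alpha> \<Longrightarrow> p' + q' = \<beta> \<Longrightarrow>
       expand_1_2 ts p p' q q' = j_0 f q q' \<and>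
       expand_2_0 ts p p' q q' = binomial_twist \<alpha> \<beta> (j_1 f) p p' \<and>
       expand_2_1 ts p p' q q' = j_inf f (- q) (- q')"
    using Cons.IH Cons.prems by (metis list.set_intros(2))
  show ?case
  proof (cases "\<alpha>' = \<alpha> \<and> \<beta>' = \<beta>")
    case True
    note add = three_point_function_add[OF g f]
    show ?thesis
    proof (intro exI[of _ "\<lambda>p. g p + f p"] conjI allI impI)
      fix p p' q q' assume pq: "p + q = \<alpha>" "p' + q' = \<beta>"
      note ts = ts[OF pq]
      show "expand_1_2 (x # ts) p p' q q' = j_0 (\<lambda>p. g p + f p) q q'"
        using ts pq True by (simp add: x add expand_1_2_def)
      show "expand_2_1 (x # ts) p p' q q' = j_inf (\<lambda>p. g p + f p) (- q) (- q')"
        using ts pq True by (simp add: x add expand_2_1_def)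
      have "expand_2_0 (x # ts) p p' q q' = binomial_twist \<alpha> \<beta> (j_1 g) p p' + expand_2_0 ts p p' q q'"
        using pq True by (simp add: x expand_2_0_def binomial_twist_def)
      then show "expand_2_0 (x # ts) p p' q q' = binomial_twist \<alpha> \<beta> (j_1 (\<lambda>p. g p + f p)) p p'"
        using ts by (simp add: add binomial_twist_add[OF laurent_j(3)[OF g] laurent_j(3)[OF f]])
    qed (rule add)
  next
    case False
    then have "expand_1_2 (x # ts) p p' q q' = expand_1_2 ts p p' q q' \<and>
       expand_2_0 (x # ts) p p' q q' = expand_2_0 ts p p' q q' \<and>
       expand_2_1 (x # ts) p p' q q' = expand_2_1 ts p p' q q'"
      if "p + q = \<alpha>" "p' + q' = \<beta>" for p p' q q'
      using that by (auto simp: x expand_1_2_def expand_2_0_def expand_2_1_def)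
    then show ?thesis using f ts by auto
  qed
qed

section \<open>Linear maps on subspaces and tensor products\<close>

lemma linear_on_add: "linear_on V f \<Longrightarrow> x \<in> V \<Longrightarrow> y \<in> V \<Longrightarrow> f (x + y) = f x + f y"
  by (simp add: linear_on_def)

lemma linear_on_scale: "linear_on V f \<Longrightarrow> x \<in> V \<Longrightarrow> f (scaleC c x) = scaleC c (f x)"
  by (simp add: linear_on_def)

lemma linear_on_0: "linear_on V f \<Longrightarrow> cvs.subspace V \<Longrightarrow> f 0 = 0"
  using linear_on_scale[of V f 0 0] cvs.subspace_0[of V] by simp

lemma linear_on_diff:
  assumes "linear_on V f" "cvs.subspace V" "x \<in> V" "y \<in> V"
  shows "f (x - y) = f x - f y"
proof -
  have "f (x - y + y) = f (x - y) + f y"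
    using cvs.subspace_diff[OF assms(2-4)] assms(4) by (rule linear_on_add[OF assms(1)])
  then show ?thesis by simp
qed

lemma linear_on_subset: "linear_on V f \<Longrightarrow> W \<subseteq> V \<Longrightarrow> linear_on W f"
  unfolding linear_on_def by blast

lemma linear_on_compose:
  assumes "linear_on V f" "linear_on W g" "\<And>x. x \<in> V \<Longrightarrow> f x \<in> W"
  shows "linear_on V (\<lambda>x. g (f x))"
  using assms by (simp add: linear_on_def)

lemma linear_on_eq_span:
  assumes f: "linear_on (cvs.span S) f" and g: "linear_on (cvs.span S) g"
    and eq: "\<And>x. x \<in> S \<Longrightarrow> f x = g x" and x: "x \<in> cvs.span S"
  shows "f x = g x"
proof -
  have "x \<in> cvs.span S \<and> f x = g x"
    using x
  proof (induction rule: cvs.span_induct_alt)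
    case base
    show ?case
      using linear_on_0[OF f cvs.subspace_span] linear_on_0[OF g cvs.subspace_span] cvs.span_zero by simp
  next
    case (step c x y)
    have x: "x \<in> cvs.span S" "scaleC c x \<in> cvs.span S"
      using step(1) by (auto intro: cvs.span_base cvs.span_scale)
    have "f (scaleC c x + y) = g (scaleC c x + y)"
      using linear_on_add[OF f x(2)] linear_on_add[OF g x(2)] linear_on_scale[OF f x(1)]
        linear_on_scale[OF g x(1)] eq[OF step(1)] step(2) by simp
    then show ?case using x step(2) by (auto intro: cvs.span_add)
  qed
  then show ?thesis ..
qed

text \<open>
  Extend the singleton to a basis; this supplies the functionals that detect vectors below.
\<close>

lemma exists_functional:
  fixes y :: "'a::complex_vector"
  assumes "y \<noteq> 0"
  obtains \<phi> :: "'a \<Rightarrow> complex" where "linear_on UNIV \<phi>" "\<phi> y = 1"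
proof -
  interpret vector_space_pair "scaleC :: complex \<Rightarrow> 'a \<Rightarrow> 'a" "scaleC :: complex \<Rightarrow> complex \<Rightarrow> complex" ..
  have "cvs.independent {y}" using assms by (simp add: cvs.dependent_single)
  from linear_independent_extend[OF this, of "\<lambda>_. 1"]
  obtain g where g: "Vector_Spaces.linear scaleC scaleC g" "g y = (1 :: complex)" by auto
  interpret g: Vector_Spaces.linear scaleC scaleC g by (rule g)
  show ?thesis using g by (intro that[of g]) (auto simp: linear_on_def g.add g.scale)
qed

lemma bilinear_on_tensor_pure: "bilinear_on UNIV UNIV (\<otimes>)"
proof -
  have rel: "abs_tensor x = abs_tensor y" if "x - y \<in> tensor_relators" for x y :: "('a \<times> 'b) \<Rightarrow>\<^sub>0 complex"
    using that by (auto simp: tensor.abs_eq_iff tensor_rel_def intro: cvs.span_base)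
  have "(a + a') \<otimes> b = a \<otimes> b + a' \<otimes> b" for a a' :: 'a and b :: 'b
    unfolding tensor_pure.abs_eq plus_tensor.abs_eq
    by (rule rel, unfold tensor_relators_def diff_diff_eq[symmetric]) blast
  moreover have "a \<otimes> (b + b') = a \<otimes> b + a \<otimes> b'" for a :: 'a and b b' :: 'b
    unfolding tensor_pure.abs_eq plus_tensor.abs_eq
    by (rule rel, unfold tensor_relators_def diff_diff_eq[symmetric]) blast
  moreover have "scaleC c a \<otimes> b = scaleC c (a \<otimes> b)" for c and a :: 'a and b :: 'b
    unfolding tensor_pure.abs_eq scaleC_tensor.abs_eq
    by (rule rel, unfold tensor_relators_def) blast
  moreover have "a \<otimes> scaleC c b = scaleC c (a \<otimes> b)" for c and a :: 'a and b :: 'b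
    unfolding tensor_pure.abs_eq scaleC_tensor.abs_eq
    by (rule rel, unfold tensor_relators_def) blast
  ultimately show ?thesis by (simp add: bilinear_on_def linear_on_def)
qed

section \<open>Holomorphic and antiholomorphic fields\<close>

lemma binomial_twist_constant:
  "binomial_twist \<alpha> \<beta> (\<lambda>s t. if s = 0 \<and> t = 0 then C else 0) (real i) (real k) =
    of_real (\<alpha> gchoose i) * of_real (\<beta> gchoose k) * C"
  by (subst binomial_twist_eq[of "{(i, k)}"]) (auto split: if_splits)

text \<open>
  The higher binomial terms contribute to the constant term only through negative exponents of \<open>a\<close>.
\<close>

lemma binomial_twist_at_0:
  assumes "\<And>s t. s \<noteq> 0 \<or> t \<notin> \<nat> \<Longrightarrow> a s t = 0"
  shows "binomial_twist \<alpha> \<beta> a 0 0 = a 0 0"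
proof -
  have "{(i, k). a (0 - real i) (0 - real k) \<noteq> 0} \<subseteq> {(0, 0)}"
  proof clarify
    fix i k assume "a (0 - real i) (0 - real k) \<noteq> 0"
    then have "0 - real i = 0" "0 - real k \<in> \<nat>" using assms by blast+
    then show "i = 0 \<and> k = 0" by (auto elim!: Nats_cases)
  qed
  then show ?thesis by (subst binomial_twist_eq[of "{(0, 0)}"]) auto
qed

context full_vertex_algebra
begin

lemma fspace_subspace: "cvs.subspace (fspace F)"
  using grading by (simp add: is_direct_sum_def)

lemma vacuum_in: "vacuum F \<in> fspace F"
  using grading vacuum_grade by (force simp: is_direct_sum_def)

text \<open>
  A nonzero vector has a nonzero homogeneous component. A functional that detects this component,
  composed with the projection onto its degree, is supported in a single degree and so lies in the
  restricted dual.
\<close>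

lemma restricted_dual_separates:
  assumes x: "x \<in> fspace F" and zero: "\<And>u. u \<in> restricted_dual F \<Longrightarrow> u x = 0"
  shows "x = 0"
proof (rule ccontr)
  assume "x \<noteq> 0"
  define G where "G = (\<lambda>(h, h'). grade F h h')"
  define comp where "comp v = (THE x. (\<forall>i. x i \<in> G i) \<and> finite {i. x i \<noteq> 0} \<and>
      v = (\<Sum>i | x i \<noteq> 0. x i))" for v
  have gr: "is_direct_sum (fspace F) G" using grading by (simp only: G_def)
  have sub: "cvs.subspace (G i)" "G i \<subseteq> fspace F" for i
    using gr unfolding is_direct_sum_def by blast+
  have ex1: "\<exists>!x. (\<forall>i. x i \<in> G i) \<and> finite {i. x i \<noteq> 0} \<and> v = (\<Sum>i | x i \<noteq> 0. x i)"
    if "v \<in> fspace F" for v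
    using gr that unfolding is_direct_sum_def by blast
  have comp: "comp v i \<in> G i" "finite {i. comp v i \<noteq> 0}" "v = (\<Sum>i | comp v i \<noteq> 0. comp v i)"
    if "v \<in> fspace F" for v i
    using theI'[OF ex1[OF that], folded comp_def] by blast+
  have compI: "comp v = y"
    if "v \<in> fspace F" "\<And>i. y i \<in> G i" "finite S" "\<And>i. i \<notin> S \<Longrightarrow> y i = 0" "v = sum y S" for v y S
  proof -
    have "{i. y i \<noteq> 0} \<subseteq> S" using that(4) by auto
    then have "finite {i. y i \<noteq> 0}" "v = (\<Sum>i | y i \<noteq> 0. y i)"
      using that(3,5) by (auto intro: finite_subset sum.mono_neutral_right)
    then show ?thesis
      unfolding comp_def using that(2) by (intro the1_equality[OF ex1[OF that(1)]]) auto
  qed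
  have comp_sum: "v = sum (comp v) S" if "v \<in> fspace F" "finite S" "{i. comp v i \<noteq> 0} \<subseteq> S" for v S
    using sum.mono_neutral_left[OF that(2,3), of "comp v"] comp(3)[OF that(1)] by auto
  have comp_add: "comp (v + w) = (\<lambda>i. comp v i + comp w i)" if v: "v \<in> fspace F" and w: "w \<in> fspace F" for v w
  proof (rule compI)
    let ?S = "{i. comp v i \<noteq> 0} \<union> {i. comp w i \<noteq> 0}"
    show "finite ?S" using comp v w by auto
    show "v + w = (\<Sum>i\<in>?S. comp v i + comp w i)"
      unfolding sum.distrib using comp_sum[OF v \<open>finite ?S\<close>] comp_sum[OF w \<open>finite ?S\<close>] by auto
  qed (use v w comp sub fspace_subspace in \<open>auto intro: cvs.subspace_add\<close>)
  have comp_scale: "comp (scaleC c v) = (\<lambda>i. scaleC c (comp v i))" if v: "v \<in> fspace F" for c v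
  proof (rule compI)
    show "finite {i. comp v i \<noteq> 0}" using comp v by auto
    show "scaleC c v = (\<Sum>i | comp v i \<noteq> 0. scaleC c (comp v i))"
      using comp(3)[OF v] by (simp add: cvs.scale_sum_right[symmetric])
  qed (use v comp sub fspace_subspace in \<open>auto intro: cvs.subspace_scale\<close>)
  have "\<exists>i. comp x i \<noteq> 0"
  proof (rule ccontr)
    assume "\<nexists>i. comp x i \<noteq> 0"
    then have "{i. comp x i \<noteq> 0} = {}" by blast
    then show False using comp(3)[OF x] \<open>x \<noteq> 0\<close> by (simp only: sum.empty)
  qed
  then obtain i where i: "comp x i \<noteq> 0" by blast
  obtain \<phi> where \<phi>: "linear_on UNIV \<phi>" "\<phi> (comp x i) = (1 :: complex)"
    using exists_functional[OF i] by blast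
  define u where "u v = \<phi> (comp v i)" for v
  have "linear_on (fspace F) u"
    using \<phi>(1) unfolding linear_on_def by (simp add: u_def comp_add comp_scale)
  moreover have "finite {(h, h'). \<exists>v\<in>grade F h h'. u v \<noteq> 0}"
  proof (rule finite_subset)
    show "{(h, h'). \<exists>v\<in>grade F h h'. u v \<noteq> 0} \<subseteq> {i}"
    proof clarify
      fix h h' v assume v: "v \<in> grade F h h'" "u v \<noteq> 0"
      have "comp v = (\<lambda>j. if j = (h, h') then v else 0)"
      proof (rule compI[of _ _ "{(h, h')}"])
        show "v \<in> fspace F" using v sub[of "(h, h')"] by (auto simp: G_def)
        show "(if j = (h, h') then v else 0) \<in> G j" for j
          using v cvs.subspace_0[OF sub(1)[of j]] by (auto simp: G_def)
      qed auto
      then show "(h, h') = i"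
        using v(2) linear_on_0[OF \<phi>(1) cvs.subspace_UNIV] by (auto simp: u_def split: if_splits)
    qed
  qed simp
  ultimately have "u \<in> restricted_dual F" by (simp add: restricted_dual_def)
  from zero[OF this] show False using \<phi>(2) by (simp add: u_def)
qed

lemma eq_by_restricted_dual:
  assumes "x \<in> fspace F" "y \<in> fspace F" "\<And>u. u \<in> restricted_dual F \<Longrightarrow> u x = u y"
  shows "x = y"
proof -
  have "x - y = 0"
  proof (rule restricted_dual_separates)
    fix u assume "u \<in> restricted_dual F"
    then show "u (x - y) = 0"
      using assms linear_on_diff[OF _ fspace_subspace assms(1,2), of u] by (simp add: restricted_dual_def)
  qed (use assms cvs.subspace_diff[OF fspace_subspace] in auto)
  then show ?thesis by simp
qed

lemma vertex_op_closed: "a \<in> fspace F \<Longrightarrow> b \<in> fspace F \<Longrightarrow> vertex_op F a b p q \<in> fspace F"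
  by (simp add: vertex_op_def mode_closed)

lemma vertex_op_linear_left: "b \<in> fspace F \<Longrightarrow> linear_on (fspace F) (\<lambda>a. vertex_op F a b p q)"
  using mode_bilinear by (simp add: vertex_op_def bilinear_on_def)

lemma vertex_op_linear_right: "a \<in> fspace F \<Longrightarrow> linear_on (fspace F) (\<lambda>b. vertex_op F a b p q)"
  using mode_bilinear by (simp add: vertex_op_def bilinear_on_def)

lemma vertex_op_0_left: "b \<in> fspace F \<Longrightarrow> vertex_op F 0 b p q = 0"
  using linear_on_0[OF vertex_op_linear_left fspace_subspace] by simp

lemma vertex_op_0_right: "a \<in> fspace F \<Longrightarrow> vertex_op F a 0 p q = 0"
  using linear_on_0[OF vertex_op_linear_right fspace_subspace] by simp

lemma restricted_dual_0: "u \<in> restricted_dual F \<Longrightarrow> u 0 = 0"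
  using linear_on_0[OF _ fspace_subspace, of u] by (simp add: restricted_dual_def)

lemma vertex_op_vacuum_left:
  "b \<in> fspace F \<Longrightarrow> vertex_op F (vacuum F) b p q = (if p = 0 \<and> q = 0 then b else 0)"
  by (auto simp: vertex_op_def FV4)

lemma vertex_op_vacuum_right: "a \<in> fspace F \<Longrightarrow> vertex_op F a (vacuum F) 0 0 = a"
  using FV3 by (simp add: vertex_op_def)

lemma D_op_eq: "D_op F a = vertex_op F a (vacuum F) 1 0"
  by (simp add: D_op_def vertex_op_def)

lemma Dbar_op_eq: "Dbar_op F a = vertex_op F a (vacuum F) 0 1"
  by (simp add: Dbar_op_def vertex_op_def)

text \<open>
  The axiom of two-point functions for fixed total exponents \<open>(\<alpha>, \<beta>)\<close>, where it involves a single
  function on the three-punctured sphere.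
\<close>

lemma correlation_function:
  assumes "a \<in> fspace F" "b \<in> fspace F" "c \<in> fspace F" "u \<in> restricted_dual F"
  obtains f where "three_point_function f"
    "\<And>q q'. j_0 f q q' = u (vertex_op F a (vertex_op F b c q q') (\<alpha> - q) (\<beta> - q'))"
    "\<And>p p'. u (vertex_op F (vertex_op F a b p p') c (\<alpha> - p) (\<beta> - p')) = binomial_twist \<alpha> \<beta> (j_1 f) p p'"
    "\<And>p p'. u (vertex_op F b (vertex_op F a c p p') (\<alpha> - p) (\<beta> - p')) = j_inf f (p - \<alpha>) (p' - \<beta>)"
proof -
  obtain \<mu> ts where pr: "presents ts \<mu>" and ts: "\<And>p p' q q'.
      u (vertex_op F a (vertex_op F b c q q') p p') = expand_1_2 ts p p' q q' \<and>
      u (vertex_op F (vertex_op F a b p p') c q q') = expand_2_0 ts p p' q q' \<and>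
      u (vertex_op F b (vertex_op F a c p p') q q') = expand_2_1 ts p p' q q'"
    using FV5[OF assms] by blast
  have "three_point_function g" if "(\<alpha>', \<beta>', g) \<in> set ts" for \<alpha>' \<beta>' g
    using pr that by (auto simp: presents_def intro: three_point_function_F_01inf)
  then obtain f where "three_point_function f" and f: "\<And>p p' q q'. p + q = \<alpha> \<Longrightarrow> p' + q' = \<beta> \<Longrightarrow>
       expand_1_2 ts p p' q q' = j_0 f q q' \<and>
       expand_2_0 ts p p' q q' = binomial_twist \<alpha> \<beta> (j_1 f) p p' \<and>
       expand_2_1 ts p p' q q' = j_inf f (- q) (- q')"
    using presentation_component[of ts \<alpha> \<beta>] by metis
  then show ?thesis
    using that[of f] ts f by (simp add: f)
qed

text \<open>
  \<open>Y(a, z\<^sub>1)Y(1, z\<^sub>2)c = Y(a, z\<^sub>1)c\<close> does not involve \<open>z\<^sub>2\<close>, so its correlation functions are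
  constant multiples of \<open>z\<^sub>1\<^sup>\<alpha> \<zbar>\<^sub>1\<^sup>\<beta>\<close>. Their expansion in \<open>z\<^sub>1 = z\<^sub>2 + z\<^sub>0\<close> is the binomial series, which
  says that \<open>Y(Y(a, z\<^sub>0)1, z\<^sub>2)\<close> is the Taylor expansion of \<open>Y(a, z\<^sub>2 + z\<^sub>0)\<close>. The cases \<open>(i, k) = (1, 0)\<close>
  and \<open>(0, 1)\<close> are the derivative rules for \<open>D\<close> and \<open>Dbar\<close>.
\<close>

lemma vertex_op_derivative:
  assumes a: "a \<in> fspace F" and c: "c \<in> fspace F" and u: "u \<in> restricted_dual F"
  shows "u (vertex_op F (vertex_op F a (vacuum F) (real i) (real k)) c (\<alpha> - real i) (\<beta> - real k)) =
    of_real (\<alpha> gchoose i) * of_real (\<beta> gchoose k) * u (vertex_op F a c \<alpha> \<beta>)"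
proof -
  obtain f where f: "three_point_function f"
    and j: "\<And>q q'. j_0 f q q' = u (vertex_op F a (vertex_op F (vacuum F) c q q') (\<alpha> - q) (\<beta> - q'))"
    and it: "\<And>p p'. u (vertex_op F (vertex_op F a (vacuum F) p p') c (\<alpha> - p) (\<beta> - p')) =
      binomial_twist \<alpha> \<beta> (j_1 f) p p'"
    using correlation_function[OF a vacuum_in c u, of \<alpha> \<beta>] by metis
  have "j_0 f = (\<lambda>s t. if s = 0 \<and> t = 0 then u (vertex_op F a c \<alpha> \<beta>) else 0)"
    using a c u by (auto simp: fun_eq_iff j vertex_op_vacuum_left vertex_op_0_right restricted_dual_0)
  from j_1_constant[OF f this] show ?thesis
    unfolding it by (simp only: binomial_twist_constant)
qed

text \<open>
  The derivative of \<open>Y(a, z)\<close> in \<open>\<zbar>\<close> is \<open>Y(Dbar a, z) = 0\<close>, and differentiation multiplies the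
  coefficient of \<open>\<zbar>\<^sup>q\<close> by \<open>q\<close>.
\<close>

lemma ker_Dbar_holomorphic:
  assumes a: "a \<in> fspace F" "Dbar_op F a = 0" and c: "c \<in> fspace F" and q: "q \<noteq> 0"
  shows "vertex_op F a c p q = 0"
proof (rule restricted_dual_separates)
  fix u assume u: "u \<in> restricted_dual F"
  have "u (vertex_op F (Dbar_op F a) c p (q - 1)) = of_real q * u (vertex_op F a c p q)"
    using vertex_op_derivative[OF a(1) c u, of 0 1 p q] by (simp add: Dbar_op_eq)
  then show "u (vertex_op F a c p q) = 0"
    using a c u q by (simp add: vertex_op_0_left restricted_dual_0)
qed (use a c vertex_op_closed in auto)

lemma ker_D_antiholomorphic:
  assumes a: "a \<in> fspace F" "D_op F a = 0" and c: "c \<in> fspace F" and p: "p \<noteq> 0"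
  shows "vertex_op F a c p q = 0"
proof (rule restricted_dual_separates)
  fix u assume u: "u \<in> restricted_dual F"
  have "u (vertex_op F (D_op F a) c (p - 1) q) = of_real p * u (vertex_op F a c p q)"
    using vertex_op_derivative[OF a(1) c u, of 1 0 p q] by (simp add: D_op_eq)
  then show "u (vertex_op F a c p q) = 0"
    using a c u p by (simp add: vertex_op_0_left restricted_dual_0)
qed (use a c vertex_op_closed in auto)

text \<open>
  If \<open>Y(a)Y(b)c\<close> has no terms with total exponents \<open>(\<alpha>, \<beta>)\<close>, then the correlation functions with these
  totals vanish near \<open>0\<close>, hence everywhere, and \<open>Y(Y(a)b)c\<close> has no such terms either.
\<close>

lemma iterate_vanishes:
  assumes a: "a \<in> fspace F" and b: "b \<in> fspace F" and c: "c \<in> fspace F"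
    and zero: "\<And>q q'. vertex_op F a (vertex_op F b c q q') (\<alpha> - q) (\<beta> - q') = 0"
  shows "vertex_op F (vertex_op F a b p p') c (\<alpha> - p) (\<beta> - p') = 0"
proof (rule restricted_dual_separates)
  fix u assume u: "u \<in> restricted_dual F"
  obtain f where f: "three_point_function f"
    and j: "\<And>q q'. j_0 f q q' = u (vertex_op F a (vertex_op F b c q q') (\<alpha> - q) (\<beta> - q'))"
    and it: "\<And>p p'. u (vertex_op F (vertex_op F a b p p') c (\<alpha> - p) (\<beta> - p')) =
      binomial_twist \<alpha> \<beta> (j_1 f) p p'"
    using correlation_function[OF a b c u, of \<alpha> \<beta>] by metis
  have "j_0 f = (\<lambda>s t. if s = 0 \<and> t = 0 then 0 else 0)"
    using u by (auto simp: fun_eq_iff j zero restricted_dual_0)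
  from j_1_constant[OF f this]
  show "u (vertex_op F (vertex_op F a b p p') c (\<alpha> - p) (\<beta> - p')) = 0"
    unfolding it by (simp add: binomial_twist_0)
qed (use a b c vertex_op_closed in auto)

text \<open>
  \<open>Dbar (a\<^sub>p\<^sub>0c)\<close> is a coefficient of \<open>Y(Y(a)c)1\<close> with antiholomorphic total exponent \<open>1\<close>, whereas
  \<open>Y(a)Y(c)1\<close> contains only the antiholomorphic exponent \<open>0\<close>.
\<close>

lemma ker_Dbar_closed:
  assumes a: "a \<in> fspace F" "Dbar_op F a = 0" and c: "c \<in> fspace F" "Dbar_op F c = 0"
  shows "Dbar_op F (vertex_op F a c p q) = 0"
proof (cases "q = 0")
  case True
  have "vertex_op F a (vertex_op F c (vacuum F) s t) (p - s) (1 - t) = 0" for s t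
    using ker_Dbar_holomorphic[OF a vertex_op_closed[OF c(1) vacuum_in]]
      ker_Dbar_holomorphic[OF c vacuum_in] vertex_op_0_right[OF a(1)]
    by (cases "t = 0") auto
  from iterate_vanishes[OF a(1) c(1) vacuum_in this, of p 0] show ?thesis
    by (simp add: Dbar_op_eq True)
next
  case False
  then show ?thesis
    using ker_Dbar_holomorphic[OF a c(1)] vertex_op_0_left[OF vacuum_in] by (simp add: Dbar_op_eq)
qed

lemma ker_D_closed:
  assumes a: "a \<in> fspace F" "D_op F a = 0" and c: "c \<in> fspace F" "D_op F c = 0"
  shows "D_op F (vertex_op F a c p q) = 0"
proof (cases "p = 0")
  case True
  have "vertex_op F a (vertex_op F c (vacuum F) s t) (1 - s) (q - t) = 0" for s t
    using ker_D_antiholomorphic[OF a vertex_op_closed[OF c(1) vacuum_in]]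
      ker_D_antiholomorphic[OF c vacuum_in] vertex_op_0_right[OF a(1)]
    by (cases "s = 0") auto
  from iterate_vanishes[OF a(1) c(1) vacuum_in this, of 0 q] show ?thesis
    by (simp add: D_op_eq True)
next
  case False
  then show ?thesis
    using ker_D_antiholomorphic[OF a c(1)] vertex_op_0_left[OF vacuum_in] by (simp add: D_op_eq)
qed

text \<open>
  The product \<open>Y(a, z\<^sub>1)Y(b, z\<^sub>2)c\<close> contains only powers of \<open>z\<^sub>1\<close> and \<open>\<zbar>\<^sub>2\<close>, so with total exponents
  \<open>(p, q)\<close> a single coefficient \<open>C\<close> survives and the correlation function is \<open>C z\<^sub>1\<^sup>p \<zbar>\<^sub>2\<^sup>q\<close>, regular at
  \<open>z\<^sub>1 = z\<^sub>2\<close>. The other two compositions therefore have the same coefficient.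
\<close>

lemma chiral_product:
  assumes a: "a \<in> fspace F" "Dbar_op F a = 0" and b: "b \<in> fspace F" "D_op F b = 0"
    and c: "c \<in> fspace F"
  shows "vertex_op F (vertex_op F a b 0 0) c p q = vertex_op F a (vertex_op F b c 0 q) p 0"
    and "vertex_op F b (vertex_op F a c p 0) 0 q = vertex_op F a (vertex_op F b c 0 q) p 0"
proof -
  have both: "u (vertex_op F (vertex_op F a b 0 0) c p q) = u (vertex_op F a (vertex_op F b c 0 q) p 0) \<and>
    u (vertex_op F b (vertex_op F a c p 0) 0 q) = u (vertex_op F a (vertex_op F b c 0 q) p 0)"
    if u: "u \<in> restricted_dual F" for u
  proof -
    define C where "C = u (vertex_op F a (vertex_op F b c 0 q) p 0)"
    obtain f where f: "three_point_function f"
      and j: "\<And>s t. j_0 f s t = u (vertex_op F a (vertex_op F b c s t) (p - s) (q - t))"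
      and it: "\<And>s t. u (vertex_op F (vertex_op F a b s t) c (p - s) (q - t)) = binomial_twist p q (j_1 f) s t"
      and rev: "\<And>s t. u (vertex_op F b (vertex_op F a c s t) (p - s) (q - t)) = j_inf f (s - p) (t - q)"
      using correlation_function[OF a(1) b(1) c u, of p q] by metis
    have j0: "j_0 f s t = (if s = 0 \<and> t = q then C else 0)" for s t
    proof (cases "s = 0 \<and> t = q")
      case False
      then have "vertex_op F a (vertex_op F b c s t) (p - s) (q - t) = 0"
        using ker_D_antiholomorphic[OF b c] vertex_op_0_right[OF a(1)]
          ker_Dbar_holomorphic[OF a vertex_op_closed[OF b(1) c]]
        by (cases "s = 0") auto
      then show ?thesis using False u by (auto simp: j restricted_dual_0)
    qed (simp add: j C_def)
    \<comment> \<open>If \<open>q\<close> is not an integer then \<open>C = 0\<close>, and any exponent serves in the monomial.\<close>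
    obtain n where n: "j_0 f = (\<lambda>s t. if s = 0 \<and> t = of_int n then C else 0)"
      and Cn: "C = 0 \<or> q = of_int n"
    proof (cases "q \<in> \<int>")
      case True
      then obtain n where "q = of_int n" by (auto elim: Ints_cases)
      then show ?thesis using that[of n] by (simp add: j0 fun_eq_iff)
    next
      case False
      then have "vertex_op F b c 0 q = 0"
        unfolding vertex_op_def using b c by (intro mode_integral) auto
      then have "C = 0" using a u by (simp add: C_def vertex_op_0_right restricted_dual_0)
      then show ?thesis using that[of 0] by (simp add: j0 fun_eq_iff)
    qed
    have "binomial_twist p q (j_1 f) 0 0 = C"
      using binomial_twist_at_0[OF j_1_antiholomorphic(2)[OF f n]] j_1_antiholomorphic(1)[OF f n] by simp
    moreover have "j_inf f 0 (- q) = C"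
      using Cn j_inf_antiholomorphic[OF f n] by auto
    ultimately show ?thesis
      using it[of 0 0] rev[of p 0] by (simp add: C_def)
  qed
  show "vertex_op F (vertex_op F a b 0 0) c p q = vertex_op F a (vertex_op F b c 0 q) p 0"
    by (rule eq_by_restricted_dual) (use a b c both in \<open>auto intro!: vertex_op_closed\<close>)
  show "vertex_op F b (vertex_op F a c p 0) 0 q = vertex_op F a (vertex_op F b c 0 q) p 0"
    by (rule eq_by_restricted_dual) (use a b c both in \<open>auto intro!: vertex_op_closed\<close>)
qed

lemma chiral_product_commute:
  assumes a: "a \<in> fspace F" "Dbar_op F a = 0" and b: "b \<in> fspace F" "D_op F b = 0"
  shows "vertex_op F a b 0 0 = vertex_op F b a 0 0"
  using chiral_product(2)[OF a b vacuum_in, of 0 0] vertex_op_vacuum_right a b by simp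

text \<open>
  Both sides equal \<open>a\<^sub>p\<^sub>0 c\<^sub>0\<^sub>0 (b\<^sub>0\<^sub>qd)\<close>. On the left, \<open>(a\<^sub>0\<^sub>0b)\<^sub>p\<^sub>q = a\<^sub>p\<^sub>0b\<^sub>0\<^sub>q\<close> and \<open>b\<^sub>0\<^sub>q\<close> commutes with
  \<open>c\<^sub>0\<^sub>0\<close>. On the right, \<open>c\<^sub>0\<^sub>0(b\<^sub>0\<^sub>qd)\<close> is rewritten as \<open>(b\<^sub>0\<^sub>qd)\<^sub>0\<^sub>0c\<close>, so that the mode \<open>a\<^sub>p\<^sub>0\<close> can be
  moved past it to act on \<open>c\<close>.
\<close>

lemma chiral_product_multiplicative:
  assumes a: "a \<in> fspace F" "Dbar_op F a = 0" and b: "b \<in> fspace F" "D_op F b = 0"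
    and c: "c \<in> fspace F" "Dbar_op F c = 0" and d: "d \<in> fspace F" "D_op F d = 0"
  shows "vertex_op F (vertex_op F a b 0 0) (vertex_op F c d 0 0) p q =
    vertex_op F (vertex_op F a c p 0) (vertex_op F b d 0 q) 0 0"
proof -
  let ?bd = "vertex_op F b d 0 q" and ?ac = "vertex_op F a c p 0"
  have bd: "?bd \<in> fspace F" "D_op F ?bd = 0"
    using b d vertex_op_closed ker_D_closed by auto
  have ac: "?ac \<in> fspace F" "Dbar_op F ?ac = 0"
    using a c vertex_op_closed ker_Dbar_closed by auto
  have "vertex_op F (vertex_op F a b 0 0) (vertex_op F c d 0 0) p q =
      vertex_op F a (vertex_op F b (vertex_op F c d 0 0) 0 q) p 0"
    using chiral_product(1)[OF a b vertex_op_closed[OF c(1) d(1)]] .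
  also have "vertex_op F b (vertex_op F c d 0 0) 0 q = vertex_op F c ?bd 0 0"
    using chiral_product(2)[OF c b d(1)] .
  also have "\<dots> = vertex_op F ?bd c 0 0" by (rule chiral_product_commute[OF c bd])
  also have "vertex_op F a \<dots> p 0 = vertex_op F ?bd ?ac 0 0"
    using chiral_product(2)[OF a bd c(1), of p 0] by simp
  also have "\<dots> = vertex_op F ?ac ?bd 0 0" by (rule chiral_product_commute[OF ac bd, symmetric])
  finally show ?thesis .
qed

section \<open>The homomorphism\<close>

lemma fspace_ker_Dbar: "fspace (ker_Dbar F) = {a \<in> fspace F. Dbar_op F a = 0}"
  by (simp add: ker_Dbar_def subalgebra_on_def)

lemma fspace_ker_D: "fspace (ker_D F) = {a \<in> fspace F. D_op F a = 0}"
  by (simp add: ker_D_def subalgebra_on_def)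

lemma kernel_subspaces:
  shows "cvs.subspace (fspace (ker_Dbar F))" "cvs.subspace (fspace (ker_D F))"
proof -
  have K: "cvs.subspace {a \<in> fspace F. vertex_op F a (vacuum F) p q = 0}" for p q
    using fspace_subspace vertex_op_linear_left[OF vacuum_in, of p q]
    by (auto simp: cvs.subspace_def linear_on_def vertex_op_0_left[OF vacuum_in])
  show "cvs.subspace (fspace (ker_Dbar F))" "cvs.subspace (fspace (ker_D F))"
    unfolding fspace_ker_Dbar fspace_ker_D Dbar_op_eq D_op_eq by (rule K)+
qed

lemma t_map_vertex_op:
  "a \<in> fspace (ker_Dbar F) \<Longrightarrow> b \<in> fspace (ker_D F) \<Longrightarrow> t_map F (a \<otimes> b) = vertex_op F a b 0 0"
  by (simp add: t_map_pure vertex_op_def)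

lemma t_map_linear: "linear_on UNIV (t_map F)"
  unfolding t_map_def
proof (rule tensor_lift_pure(1)[OF kernel_subspaces])
  show "bilinear_on (fspace (ker_Dbar F)) (fspace (ker_D F)) (\<lambda>a b. mode F a (- 1) (- 1) b)"
    using mode_bilinear[of "-1" "-1"]
    by (auto simp: bilinear_on_def linear_on_def fspace_ker_Dbar fspace_ker_D)
qed

lemma t_map_closed:
  assumes "x \<in> tensor_space (fspace (ker_Dbar F)) (fspace (ker_D F))"
  shows "t_map F x \<in> fspace F"
  using assms unfolding tensor_space_def
proof (induction rule: cvs.span_induct_alt)
  case base
  show ?case
    using linear_on_0[OF t_map_linear cvs.subspace_UNIV] cvs.subspace_0[OF fspace_subspace] by simp
next
  case (step c x y)
  then have "t_map F x \<in> fspace F"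
    by (auto simp: t_map_vertex_op fspace_ker_Dbar fspace_ker_D vertex_op_closed)
  with step(2) show ?case
    using linear_on_add[OF t_map_linear] linear_on_scale[OF t_map_linear] fspace_subspace
    by (simp add: cvs.subspace_add cvs.subspace_scale)
qed

lemma mode_vertex_op: "mode F a r s b = vertex_op F a b (- r - 1) (- s - 1)"
  by (simp add: vertex_op_def)

text \<open>
  A nonzero term of the defining sum needs the second index of the mode of \<open>a\<close> and the first index of
  the mode of \<open>b\<close> to be \<open>- 1\<close>, and this fixes the two other indices.
\<close>

lemma tensor_mode_pure_chiral:
  assumes a: "a \<in> fspace (ker_Dbar F)" and b: "b \<in> fspace (ker_D F)"
    and c: "c \<in> fspace (ker_Dbar F)" and d: "d \<in> fspace (ker_D F)"
  shows "tensor_mode_pure (ker_Dbar F) (ker_D F) r s a b c d =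
    vertex_op F a c (- r - 1) 0 \<otimes> vertex_op F b d 0 (- s - 1)"
proof -
  have tensor_0: "0 \<otimes> y = 0" "x \<otimes> 0 = 0" for x y :: 'a
    using bilinear_on_tensor_pure linear_on_0[OF _ cvs.subspace_UNIV, of "\<lambda>x. x \<otimes> y"]
      linear_on_0[OF _ cvs.subspace_UNIV, of "(\<otimes>) x"]
    by (auto simp: bilinear_on_def)
  have modes: "mode (ker_Dbar F) = mode F" "mode (ker_D F) = mode F"
    by (simp_all add: ker_Dbar_def ker_D_def subalgebra_on_def)
  define T where "T = (\<lambda>(r1, s1). mode F a r1 s1 c \<otimes> mode F b (r - 1 - r1) (s - 1 - s1) d)"
  have "T x = 0" if "x \<noteq> (r, -1)" for x
  proof -
    obtain r1 s1 where x: "x = (r1, s1)" by (cases x)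
    have "s1 \<noteq> -1 \<or> r1 \<noteq> r" using that x by auto
    then show ?thesis
    proof
      assume "s1 \<noteq> -1"
      then have "mode F a r1 s1 c = 0"
        unfolding mode_vertex_op using a c ker_Dbar_holomorphic[of a c] by (simp add: fspace_ker_Dbar)
      then show ?thesis by (simp add: T_def x tensor_0)
    next
      assume "r1 \<noteq> r"
      then have "mode F b (r - 1 - r1) (s - 1 - s1) d = 0"
        unfolding mode_vertex_op using b d ker_D_antiholomorphic[of b d] by (simp add: fspace_ker_D)
      then show ?thesis by (simp add: T_def x tensor_0)
    qed
  qed
  then have "sum T {x. T x \<noteq> 0} = sum T {(r, -1)}"
    by (intro sum.mono_neutral_left) auto
  also have "\<dots> = mode F a r (-1) c \<otimes> mode F b (-1) s d"
    by (simp add: T_def)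
  also have "\<dots> = vertex_op F a c (- r - 1) 0 \<otimes> vertex_op F b d 0 (- s - 1)"
    by (simp add: mode_vertex_op)
  finally show ?thesis
    unfolding tensor_mode_pure_def modes T_def by (simp add: case_prod_unfold)
qed

text \<open>
  On pure tensors this is \<open>chiral_product_multiplicative\<close>. The modes of the tensor product are
  iterated linear extensions: \<open>L r s a b y\<close> is \<open>(a \<otimes> b)(r,s)y\<close>, extended linearly in \<open>y\<close>, and
  \<open>M r s x y\<close> is \<open>x(r,s)y\<close>. The second extension exists only because \<open>L r s a b y\<close> is bilinear in
  \<open>(a, b)\<close> for \<open>y\<close> in the tensor product of the two kernels, which is again checked on pure tensors.
\<close>

lemma t_map_homomorphism: "fva_hom (tensor_fva (ker_Dbar F) (ker_D F)) F (t_map F)"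
proof -
  let ?K = "fspace (ker_Dbar F)" and ?K' = "fspace (ker_D F)"
  let ?pure = "{v \<otimes> w | v w. v \<in> ?K \<and> w \<in> ?K'}"
  define L where "L r s a b = tensor_lift ?K ?K' (tensor_mode_pure (ker_Dbar F) (ker_D F) r s a b)" for r s a b
  define M where "M r s x y = tensor_lift ?K ?K' (\<lambda>a b. L r s a b y) x" for r s x y
  have tensor_bilinear: "(x + x') \<otimes> y = x \<otimes> y + x' \<otimes> y" "x \<otimes> (y + y') = x \<otimes> y + x \<otimes> y'"
    "scaleC k x \<otimes> y = scaleC k (x \<otimes> y)" "x \<otimes> scaleC k y = scaleC k (x \<otimes> y)" for x x' y y' :: 'a and k
    using bilinear_on_tensor_pure[where ?'a = 'a and ?'b = 'a] by (auto simp: bilinear_on_def linear_on_def)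
  have in_F: "a \<in> fspace F" if "a \<in> ?K \<or> a \<in> ?K'" for a
    using that by (auto simp: fspace_ker_Dbar fspace_ker_D)
  have lin_left: "vertex_op F (a + a') b p q = vertex_op F a b p q + vertex_op F a' b p q"
    "vertex_op F (scaleC k a) b p q = scaleC k (vertex_op F a b p q)"
    if "b \<in> fspace F" "a \<in> fspace F" "a' \<in> fspace F" for a a' b p q k
    using that vertex_op_linear_left by (simp_all add: linear_on_def)
  have lin_right: "vertex_op F a (b + b') p q = vertex_op F a b p q + vertex_op F a b' p q"
    "vertex_op F a (scaleC k b) p q = scaleC k (vertex_op F a b p q)"
    if "a \<in> fspace F" "b \<in> fspace F" "b' \<in> fspace F" for a b b' p q k
    using that vertex_op_linear_right by (simp_all add: linear_on_def)
  note lin = lin_left(1) lin_left(2)[OF _ _ vacuum_in] lin_right(1) lin_right(2)[OF _ _ vacuum_in]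
  note sub = kernel_subspaces(1)[THEN cvs.subspace_add] kernel_subspaces(1)[THEN cvs.subspace_scale]
  note sub' = kernel_subspaces(2)[THEN cvs.subspace_add] kernel_subspaces(2)[THEN cvs.subspace_scale]
  have bil: "bilinear_on ?K ?K' (tensor_mode_pure (ker_Dbar F) (ker_D F) r s a b)"
    if a: "a \<in> ?K" and b: "b \<in> ?K'" for r s a b
    unfolding bilinear_on_def linear_on_def
    using a b by (auto simp: tensor_mode_pure_chiral sub sub' lin in_F tensor_bilinear)
  have L_lin: "linear_on UNIV (L r s a b)" if "a \<in> ?K" "b \<in> ?K'" for r s a b
    unfolding L_def using bil[OF that] by (rule tensor_lift_pure(1)[OF kernel_subspaces])
  have L_pure: "L r s a b (c \<otimes> d) = vertex_op F a c (- r - 1) 0 \<otimes> vertex_op F b d 0 (- s - 1)"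
    if "a \<in> ?K" "b \<in> ?K'" "c \<in> ?K" "d \<in> ?K'" for r s a b c d
    unfolding L_def using tensor_lift_pure(2)[OF kernel_subspaces bil[OF that(1,2)] that(3,4)] that
    by (simp add: tensor_mode_pure_chiral)
  have M_bil: "bilinear_on ?K ?K' (\<lambda>a b. L r s a b y)" if y: "y \<in> cvs.span ?pure" for r s y
  proof -
    have lin_sum: "linear_on (cvs.span ?pure) (\<lambda>y. f y + g y)"
      if "linear_on UNIV f" "linear_on UNIV g" for f g :: "('a, 'a) tensor \<Rightarrow> ('a, 'a) tensor"
      using that by (simp add: linear_on_def scaleC_add_right)
    have lin_scale: "linear_on (cvs.span ?pure) (\<lambda>y. scaleC k (f y))"
      if "linear_on UNIV f" for k and f :: "('a, 'a) tensor \<Rightarrow> ('a, 'a) tensor"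
      using that by (simp add: linear_on_def scaleC_add_right scaleC_scaleC mult.commute)
    note lin_L = linear_on_subset[OF L_lin subset_UNIV]
    have "L r s (a + a') b y = L r s a b y + L r s a' b y" if "a \<in> ?K" "a' \<in> ?K" "b \<in> ?K'" for a a' b
      by (rule linear_on_eq_span[OF lin_L lin_sum[OF L_lin L_lin] _ y])
         (use that in \<open>auto simp: L_pure sub lin in_F tensor_bilinear\<close>)
    moreover have "L r s a (b + b') y = L r s a b y + L r s a b' y" if "a \<in> ?K" "b \<in> ?K'" "b' \<in> ?K'" for a b b'
      by (rule linear_on_eq_span[OF lin_L lin_sum[OF L_lin L_lin] _ y])
         (use that in \<open>auto simp: L_pure sub' lin in_F tensor_bilinear\<close>)
    moreover have "L r s (scaleC k a) b y = scaleC k (L r s a b y)" if "a \<in> ?K" "b \<in> ?K'" for a b k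
      by (rule linear_on_eq_span[OF lin_L lin_scale[OF L_lin] _ y])
         (use that in \<open>auto simp: L_pure sub lin in_F tensor_bilinear\<close>)
    moreover have "L r s a (scaleC k b) y = scaleC k (L r s a b y)" if "a \<in> ?K" "b \<in> ?K'" for a b k
      by (rule linear_on_eq_span[OF lin_L lin_scale[OF L_lin] _ y])
         (use that in \<open>auto simp: L_pure sub' lin in_F tensor_bilinear\<close>)
    ultimately show ?thesis by (simp add: bilinear_on_def linear_on_def)
  qed
  have M_lin: "linear_on UNIV (\<lambda>x. M r s x y)" if "y \<in> cvs.span ?pure" for r s y
    unfolding M_def using tensor_lift_pure(1)[OF kernel_subspaces M_bil[OF that]] by simp
  have M_pure: "M r s (a \<otimes> b) y = L r s a b y" if "y \<in> cvs.span ?pure" "a \<in> ?K" "b \<in> ?K'" for r s a b y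
    unfolding M_def using tensor_lift_pure(2)[OF kernel_subspaces M_bil[OF that(1)] that(2,3)] .
  have t_closed: "t_map F x \<in> fspace F" if "x \<in> cvs.span ?pure" for x
    using t_map_closed that by (simp add: tensor_space_def)
  note t_lin = linear_on_subset[OF t_map_linear subset_UNIV]
  have hom_pure: "t_map F (L r s a b y) = mode F (t_map F (a \<otimes> b)) r s (t_map F y)"
    if y: "y \<in> cvs.span ?pure" and a: "a \<in> ?K" and b: "b \<in> ?K'" for r s a b y
  proof (rule linear_on_eq_span[OF _ _ _ y])
    show "linear_on (cvs.span ?pure) (\<lambda>y. t_map F (L r s a b y))"
      by (rule linear_on_compose[OF linear_on_subset[OF L_lin[OF a b] subset_UNIV] t_map_linear]) simp
    have "t_map F (a \<otimes> b) \<in> fspace F"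
      using a b by (intro t_closed cvs.span_base) blast
    then show "linear_on (cvs.span ?pure) (\<lambda>y. mode F (t_map F (a \<otimes> b)) r s (t_map F y))"
      unfolding mode_vertex_op
      by (rule linear_on_compose[OF t_lin vertex_op_linear_right[OF _]]) (auto intro: t_closed)
    fix x assume "x \<in> ?pure"
    then obtain c d where x: "x = c \<otimes> d" and c: "c \<in> ?K" and d: "d \<in> ?K'" by blast
    have ac: "vertex_op F a c (- r - 1) 0 \<in> ?K" and bd: "vertex_op F b d 0 (- s - 1) \<in> ?K'"
      using a b c d ker_Dbar_closed ker_D_closed vertex_op_closed by (auto simp: fspace_ker_Dbar fspace_ker_D)
    show "t_map F (L r s a b x) = mode F (t_map F (a \<otimes> b)) r s (t_map F x)"
      unfolding x L_pure[OF a b c d] t_map_vertex_op[OF ac bd] t_map_vertex_op[OF a b]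
        t_map_vertex_op[OF c d] mode_vertex_op
      using a b c d by (intro chiral_product_multiplicative[symmetric]) (auto simp: fspace_ker_Dbar fspace_ker_D)
  qed
  have hom: "t_map F (M r s x y) = mode F (t_map F x) r s (t_map F y)"
    if x: "x \<in> cvs.span ?pure" and y: "y \<in> cvs.span ?pure" for r s x y
  proof (rule linear_on_eq_span[OF _ _ _ x])
    show "linear_on (cvs.span ?pure) (\<lambda>x. t_map F (M r s x y))"
      by (rule linear_on_compose[OF linear_on_subset[OF M_lin[OF y] subset_UNIV] t_map_linear]) simp
    show "linear_on (cvs.span ?pure) (\<lambda>x. mode F (t_map F x) r s (t_map F y))"
      unfolding mode_vertex_op
      by (intro linear_on_compose[OF t_lin vertex_op_linear_left] t_closed y)
    fix x assume "x \<in> ?pure"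
    then show "t_map F (M r s x y) = mode F (t_map F x) r s (t_map F y)"
      using M_pure[OF y] hom_pure[OF y] by auto
  qed
  have "vacuum F \<in> ?K" "vacuum F \<in> ?K'"
    using vacuum_in by (auto simp: fspace_ker_Dbar fspace_ker_D Dbar_op_eq D_op_eq vertex_op_vacuum_left)
  then have "t_map F (vacuum F \<otimes> vacuum F) = vacuum F"
    using vacuum_in by (simp add: t_map_vertex_op vertex_op_vacuum_left)
  moreover have "vacuum (ker_Dbar F) = vacuum F" "vacuum (ker_D F) = vacuum F"
    by (simp_all add: ker_Dbar_def ker_D_def subalgebra_on_def)
  ultimately show ?thesis
    using hom t_closed t_lin
    by (auto simp: fva_hom_def tensor_fva_def tensor_space_def M_def L_def)
qed

end

theorem proposition3p18:
  fixes F :: "'a::complex_vector fva_data"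
  assumes "full_vertex_algebra F"
    and "spectrum_discrete (ker_Dbar F)"
    and "spectrum_bounded_below (ker_D F)"
  shows "fva_hom (tensor_fva (ker_Dbar F) (ker_D F)) F (t_map F)"
  using full_vertex_algebra.t_map_homomorphism[OF assms(1)] .

end
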